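(* Let $\Omega\subset\mathbb{R}^d$ be open, let $(M_p)_{p\in\mathbb{N}}$ be a weight sequence satisfying (M.1), (M.2), (M.3), and let $K\subset\subset\Omega$ be a (regular) compact set. (Beurling case) Let $f=[(f_\varepsilon)]\in\mathcal{G}^{(M_p)}(\Omega)$ be such that $\operatorname{supp}f_\varepsilon\subset K$ for all $\varepsilon\in(0,1)$, and suppose there exists $\tilde r>0$ such that for every $\phi\in\mathcal{D}^{M_p,\tilde r}(K)$, $$\Big(\int_{\mathbb{R}^d}f_\varepsilon(x)\phi(x)\,dx\Big)_{\varepsilon\in(0,1)}\in\mathcal{N}_{\mathbb{C}}^{(M_p)}.$$ Then $f=0$ in $\mathcal{G}^{(M_p)}(\Omega)$. (Roumieu case) Let $f=[(f_\varepsilon)]\in\mathcal{G}^{\{M_p\}}(\Omega)$ be such that $\operatorname{supp}f_\varepsilon\subset K$ for all $\varepsilon\in(0,1)$, and suppose there exists $(\tilde r_i)\in\mathfrak{R}$ such that for every $\phi\in\mathcal{D}^{M_p,(\tilde r_i)}(K)$, $$\Big(\int_{\mathbb{R}^d}f_\varepsilon(x)\phi(x)\,dx\Big)_{\varepsilon\in(0,1)}\in\mathcal{N}_{\mathbb{C}}^{\{M_p\}}.$$ Then $f=0$ in $\mathcal{G}^{\{M_p\}}(\Omega)$.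
   Context: Conventions: $\mathbb{N}=\{0,1,2,\dots\}$, $\mathbb{Z}_+=\{1,2,\dots\}$. Functions are complex valued. For nets indexed by $\varepsilon\in(0,1)$, $a_\varepsilon=O(b_\varepsilon)$ means that there are $C>0$ and $\varepsilon_0\in(0,1)$ with $|a_\varepsilon|\le C b_\varepsilon$ for $\varepsilon\in(0,\varepsilon_0)$. All compact sets $K\subset\subset\Omega$ are assumed regular in the sense of Komatsu (Whitney-type regularity: finitely many connected components, and any two points $x,y$ of the same component can be joined by a rectifiable curve in $K$ of length at most $C_K|x-y|$). Weight sequence: $(M_p)_{p\in\mathbb{N}}$ is a sequence of positive numbers with $M_0=1$ such that, for some constants $c_0,H\ge1$: (M.1) $M_p^2\le M_{p-1}M_{p+1}$, $p\in\mathbb{Z}_+$; (M.2) $M_p\le c_0H^p\min_{0\le q\le p}M_{p-q}M_q$, $p\in\mathbb{N}$; (M.3) $\sum_{j=p+1}^\infty M_{j-1}/M_j\le c_0\,p\,M_p/M_{p+1}$, $p\in\mathbb{Z}_+$. For $\alpha\in\mathbb{N}^d$, $M_\alpha:=M_{|\alpha|}$. $M(\rho)=\sup_{p\in\mathbb{N}}\ln_+(\rho^p/M_p)$ for $\rho>0$, $M(0)=0$, where $\ln_+=\max(\ln,0)$. $\mathfrak{R}$ is the set of all positive monotonically increasing sequences $(r_i)_{i\in\mathbb{Z}_+}$ with $r_i\to\infty$; for $(r_i)\in\mathfrak{R}$, $N_{(r_i)}(\rho)=\sup_{p\in\mathbb{N}}\ln_+\big(\rho^p/(M_p\prod_{i=1}^pr_i)\big)$,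 $\rho>0$. Function spaces: for $K\subset\subset\Omega$, $h>0$, $(r_i)\in\mathfrak{R}$, $\phi\in C^\infty(\Omega)$ put $\|\phi\|_{K,h}=\sup_{x\in K,\alpha\in\mathbb{N}^d}\frac{|\phi^{(\alpha)}(x)|}{h^{|\alpha|}M_\alpha}$ and $\|\phi\|_{K,(r_i)}=\sup_{x\in K,\alpha\in\mathbb{N}^d}\frac{|\phi^{(\alpha)}(x)|}{M_\alpha\prod_{i\le|\alpha|}r_i}$. $\mathcal{E}^{(M_p)}(\Omega)$ (resp. $\mathcal{E}^{\{M_p\}}(\Omega)$) is the space of $\phi\in C^\infty(\Omega)$ with $\|\phi\|_{K,h}<\infty$ for all $K\subset\subset\Omega$, $h>0$ (resp. $\|\phi\|_{K,(r_i)}<\infty$ for all $K\subset\subset\Omega$, $(r_i)\in\mathfrak{R}$). $\mathcal{D}^{M_p,h}(K)$ (resp. $\mathcal{D}^{M_p,(r_i)}(K)$) is the space of $\phi\in C^\infty(\Omega)$ with support in $K$ and $\|\phi\|_{K,h}<\infty$ (resp. $\|\phi\|_{K,(r_i)}<\infty$). Generalized ultradistributions: $\mathcal{E}_M^{(M_p)}(\Omega)$ is the set of nets $(g_\varepsilon)\in(\mathcal{E}^{(M_p)}(\Omega))^{(0,1)}$ such that for all $K\subset\subset\Omega$, $h>0$ there is $k\ge0$ with $\|g_\varepsilon\|_{K,h}=O(e^{M(k/\varepsilon)})$; $\mathcal{N}^{(M_p)}(\Omega)$ is the set of nets such that for all $K$, $h>0$, $k\ge0$: $\|g_\varepsilon\|_{K,h}=O(e^{-M(k/\varepsilon)})$.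 $\mathcal{E}_M^{\{M_p\}}(\Omega)$ is the set of nets $(g_\varepsilon)\in(\mathcal{E}^{\{M_p\}}(\Omega))^{(0,1)}$ such that for all $K\subset\subset\Omega$, $(h_i)\in\mathfrak{R}$ there is $(k_i)\in\mathfrak{R}$ with $\|g_\varepsilon\|_{K,(h_i)}=O(e^{N_{(k_i)}(1/\varepsilon)})$; $\mathcal{N}^{\{M_p\}}(\Omega)$ is the set of nets such that for all $K$, $(h_i),(k_i)\in\mathfrak{R}$: $\|g_\varepsilon\|_{K,(h_i)}=O(e^{-N_{(k_i)}(1/\varepsilon)})$. For $*$ equal to $(M_p)$ or $\{M_p\}$, $\mathcal{G}^*(\Omega)=\mathcal{E}_M^*(\Omega)/\mathcal{N}^*(\Omega)$; the class of $(f_\varepsilon)$ is $[(f_\varepsilon)]$. Negligible complex nets: $\mathcal{N}_{\mathbb{C}}^{(M_p)}$ is the set of nets $(c_\varepsilon)\in\mathbb{C}^{(0,1)}$ with $|c_\varepsilon|=O(e^{-M(k/\varepsilon)})$ for every $k>0$; $\mathcal{N}_{\mathbb{C}}^{\{M_p\}}$ is the set of nets with $|c_\varepsilon|=O(e^{-N_{(k_i)}(1/\varepsilon)})$ for every $(k_i)\in\mathfrak{R}$. *)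

theory Defs
  imports "HOL-Analysis.Analysis"
begin

section \<open>Weight sequences and associated functions\<close>

definition weight_sequence :: "(nat \<Rightarrow> real) \<Rightarrow> bool" where
  "weight_sequence M \<longleftrightarrow>
     (\<forall>p. 0 < M p) \<and> M 0 = 1 \<and>
     (\<exists>c\<^sub>0 H. 1 \<le> c\<^sub>0 \<and> 1 \<le> H \<and>
        (\<forall>p\<ge>1. (M p)\<^sup>2 \<le> M (p - 1) * M (p + 1)) \<and>
        (\<forall>p. M p \<le> c\<^sub>0 * H ^ p * Min ((\<lambda>q. M (p - q) * M q) ` {0..p})) \<and>
        (\<forall>p\<ge>1. summable (\<lambda>i. M (p + i) / M (p + i + 1)) \<and>
                 (\<Sum>i. M (p + i) / M (p + i + 1)) \<le> c\<^sub>0 * real p * M p / M (p + 1)))"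

text \<open>
  The supremum is over a bounded set whenever \<open>W p / W (p + 1)\<close> tends to 0 (lemma
  \<open>assoc_fun_bdd_above\<close>), as is the case for all \<open>W\<close> used below, so the real supremum is the
  usual one. For \<open>\<rho> = 0\<close> the conventions \<open>0 ^ 0 = 1\<close> and \<open>ln 0 = 0\<close> make the value 0.
\<close>

definition assoc_fun :: "(nat \<Rightarrow> real) \<Rightarrow> real \<Rightarrow> real" where
  "assoc_fun W \<rho> = (SUP p. max (ln (\<rho> ^ p / W p)) 0)"

text \<open>Sequences in \<open>seqs_R\<close> are indexed from 1; their value at 0 plays no role.\<close>

definition seqs_R :: "(nat \<Rightarrow> real) set" where
  "seqs_R = {r. (\<forall>i\<ge>1. 0 < r i) \<and> mono_on {1..} r \<and> filterlim r at_top sequentially}"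

definition beurling_weight :: "(nat \<Rightarrow> real) \<Rightarrow> real \<Rightarrow> nat \<Rightarrow> real" where
  "beurling_weight M h p = h ^ p * M p"

definition roumieu_weight :: "(nat \<Rightarrow> real) \<Rightarrow> (nat \<Rightarrow> real) \<Rightarrow> nat \<Rightarrow> real" where
  "roumieu_weight M r p = M p * (\<Prod>i = 1..p. r i)"

definition assoc_fun_R :: "(nat \<Rightarrow> real) \<Rightarrow> (nat \<Rightarrow> real) \<Rightarrow> real \<Rightarrow> real" where
  "assoc_fun_R M r = assoc_fun (roumieu_weight M r)"

lemma assoc_fun_zero: "W 0 = 1 \<Longrightarrow> assoc_fun W 0 = 0"
proof -
  assume "W 0 = 1"
  then have "max (ln (0 ^ p / W p)) 0 = 0" for p
    by (cases p) auto
  then show ?thesis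
    by (simp add: assoc_fun_def)
qed

lemma assoc_fun_bdd_above:
  fixes W :: "nat \<Rightarrow> real"
  assumes pos: "\<And>p. 0 < W p" and lim: "(\<lambda>p. W p / W (Suc p)) \<longlonglongrightarrow> 0" and "0 \<le> \<rho>"
  shows "bdd_above (range (\<lambda>p. max (ln (\<rho> ^ p / W p)) 0))"
proof -
  have "eventually (\<lambda>p. W p / W (Suc p) < 1 / (\<rho> + 1)) sequentially"
    using \<open>0 \<le> \<rho>\<close> by (intro order_tendstoD(2)[OF lim]) auto
  then obtain n where n: "\<And>p. p \<ge> n \<Longrightarrow> W p / W (Suc p) < 1 / (\<rho> + 1)"
    by (auto simp: eventually_sequentially)
  define a where "a p = \<rho> ^ p / W p" for p
  have a_nonneg: "0 \<le> a p" for p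
    using pos[of p] \<open>0 \<le> \<rho>\<close> by (simp add: a_def)
  have step: "a (Suc p) \<le> a p" if "p \<ge> n" for p
  proof -
    have "\<rho> * (W p / W (Suc p)) \<le> \<rho> * (1 / (\<rho> + 1))"
      using n[OF that] \<open>0 \<le> \<rho>\<close> by (intro mult_left_mono) auto
    also have "\<dots> \<le> 1"
      using \<open>0 \<le> \<rho>\<close> by (simp add: field_simps)
    finally have "a p * (\<rho> * (W p / W (Suc p))) \<le> a p"
      by (rule mult_left_le[OF _ a_nonneg])
    moreover have "a (Suc p) = a p * (\<rho> * (W p / W (Suc p)))"
      using pos[of p] pos[of "Suc p"] by (simp add: a_def)
    ultimately show ?thesis
      by simp
  qed
  have tail: "a p \<le> a n" if "p \<ge> n" for p
    using that
  proof (induction p rule: dec_induct)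
    case base
    show ?case by simp
  next
    case (step m)
    then show ?case
      using \<open>\<And>p. p \<ge> n \<Longrightarrow> a (Suc p) \<le> a p\<close>[of m] by simp
  qed
  define C where "C = 1 + (\<Sum>p\<le>n. a p)"
  have "a p \<le> C" for p
  proof (cases "p \<le> n")
    case True
    then have "a p \<le> (\<Sum>p\<le>n. a p)"
      using a_nonneg by (intro member_le_sum) auto
    then show ?thesis by (simp add: C_def)
  next
    case False
    have "a n \<le> (\<Sum>p\<le>n. a p)"
      using a_nonneg by (intro member_le_sum) auto
    then show ?thesis
      using tail[of p] False by (simp add: C_def)
  qed
  moreover have "1 \<le> C"
    using a_nonneg by (simp add: C_def sum_nonneg)
  ultimately have "max (ln (a p)) 0 \<le> ln C" for p
    using a_nonneg[of p] by (cases "a p = 0") (auto simp: less_le)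
  then show ?thesis
    unfolding a_def by (intro bdd_aboveI2)
qed

lemma weight_sequence_ratio_tendsto:
  assumes "weight_sequence M"
  shows "(\<lambda>p. M p / M (Suc p)) \<longlonglongrightarrow> 0"
proof -
  have "\<forall>p\<ge>1. summable (\<lambda>i. M (p + i) / M (p + i + 1))"
    using assms unfolding weight_sequence_def by (elim conjE exE) simp
  then have "summable (\<lambda>i. M (1 + i) / M (1 + i + 1))"
    by (rule allE[of _ 1]) simp
  then have "(\<lambda>i. M (1 + i) / M (1 + i + 1)) \<longlonglongrightarrow> 0"
    by (rule summable_LIMSEQ_zero)
  then show ?thesis
    by (subst filterlim_sequentially_Suc[symmetric]) simp
qed

lemma roumieu_weight_ratio_tendsto:
  assumes "weight_sequence M" and r: "r \<in> seqs_R"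
  shows "(\<lambda>p. roumieu_weight M r p / roumieu_weight M r (Suc p)) \<longlonglongrightarrow> 0"
proof -
  have "filterlim (\<lambda>p. r (Suc p)) at_top sequentially"
    using r by (simp add: seqs_R_def filterlim_sequentially_Suc)
  then have "(\<lambda>p. 1 / r (Suc p)) \<longlonglongrightarrow> 0"
    by (intro real_tendsto_divide_at_top[OF tendsto_const])
  then have "(\<lambda>p. M p / M (Suc p) * (1 / r (Suc p))) \<longlonglongrightarrow> 0 * 0"
    by (intro tendsto_mult weight_sequence_ratio_tendsto assms)
  moreover have "roumieu_weight M r p / roumieu_weight M r (Suc p)
      = M p / M (Suc p) * (1 / r (Suc p))" for p
  proof -
    have "(\<Prod>i = 1..p. r i) \<noteq> 0"
      using r by (intro less_imp_neq[THEN not_sym] prod_pos) (auto simp: seqs_R_def)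
    moreover have "(\<Prod>i = 1..Suc p. r i) = (\<Prod>i = 1..p. r i) * r (Suc p)"
      by (simp add: prod.nat_ivl_Suc')
    ultimately show ?thesis
      by (simp add: roumieu_weight_def del: prod.cl_ivl_Suc prod_zero_iff)
  qed
  ultimately show ?thesis by simp
qed


section \<open>Regular compact sets\<close>

definition path_length :: "(real \<Rightarrow> 'a::metric_space) \<Rightarrow> ennreal" where
  "path_length \<gamma> =
     (SUP (n, t) \<in> {(n :: nat, t :: nat \<Rightarrow> real). mono_on {..n} t \<and> t ` {..n} \<subseteq> {0..1}}.
        \<Sum>i<n. ennreal (dist (\<gamma> (t i)) (\<gamma> (t (Suc i)))))"

definition regular_set :: "'a::euclidean_space set \<Rightarrow> bool" where
  "regular_set K \<longleftrightarrow>
     finite (components K) \<and>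
     (\<exists>C::real. \<forall>S\<in>components K. \<forall>x\<in>S. \<forall>y\<in>S. \<exists>\<gamma>.
        path \<gamma> \<and> path_image \<gamma> \<subseteq> K \<and> pathstart \<gamma> = x \<and> pathfinish \<gamma> = y \<and>
        path_length \<gamma> \<le> ennreal (C * norm (x - y)))"

definition regular_compact_in :: "'a::euclidean_space set \<Rightarrow> 'a set \<Rightarrow> bool" where
  "regular_compact_in K \<Omega> \<longleftrightarrow> compact K \<and> K \<subseteq> \<Omega> \<and> regular_set K"


section \<open>Ultradifferentiable functions\<close>

definition partial :: "'n::finite \<Rightarrow> (real ^ 'n \<Rightarrow> complex) \<Rightarrow> real ^ 'n \<Rightarrow> complex" where
  "partial i \<phi> x = frechet_derivative \<phi> (at x) (axis i 1)"

definition partials :: "'n::finite list \<Rightarrow> (real ^ 'n \<Rightarrow> complex) \<Rightarrow> real ^ 'n \<Rightarrow> complex" where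
  "partials is \<phi> = foldr partial is \<phi>"

text \<open>
  A function on an open set \<open>\<Omega>\<close> is represented by its extension by zero to the whole space.
  All derivatives are only ever evaluated at points of \<open>\<Omega>\<close>.
\<close>

definition C_infinity :: "(real ^ 'n::finite) set \<Rightarrow> (real ^ 'n \<Rightarrow> complex) set" where
  "C_infinity \<Omega> =
     {\<phi>. (\<forall>x. x \<notin> \<Omega> \<longrightarrow> \<phi> x = 0) \<and> (\<forall>is. \<forall>x\<in>\<Omega>. partials is \<phi> differentiable (at x))}"

text \<open>
  The derivative for a multi-index \<open>\<alpha>\<close> is taken in some order, which is immaterial for smooth
  functions: \<open>is\<close> is a list of coordinates in which each \<open>i\<close> occurs \<open>\<alpha> i\<close> times.
\<close>

definition multi_deriv ::
    "('n::finite \<Rightarrow> nat) \<Rightarrow> (real ^ 'n \<Rightarrow> complex) \<Rightarrow> real ^ 'n \<Rightarrow> complex" where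
  "multi_deriv \<alpha> \<phi> = partials (SOME is. \<forall>i. count_list is i = \<alpha> i) \<phi>"

lemma multi_index_list_exists: "\<exists>is. \<forall>i. count_list is i = (\<alpha> :: 'n::finite \<Rightarrow> nat) i"
proof -
  have "count (\<Sum>i\<in>UNIV. replicate_mset (\<alpha> i) i) j = \<alpha> j" for j
    by (simp add: count_sum)
  moreover obtain "is" where "mset is = (\<Sum>i\<in>UNIV. replicate_mset (\<alpha> i) i)"
    using ex_mset by blast
  ultimately show ?thesis
    by (metis count_mset)
qed

definition mi_order :: "('n::finite \<Rightarrow> nat) \<Rightarrow> nat" where
  "mi_order \<alpha> = (\<Sum>i\<in>UNIV. \<alpha> i)"

definition supp :: "(real ^ 'n::finite) set \<Rightarrow> (real ^ 'n \<Rightarrow> complex) \<Rightarrow> (real ^ 'n) set" where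
  "supp \<Omega> \<phi> = \<Omega> \<inter> closure {x \<in> \<Omega>. \<phi> x \<noteq> 0}"

definition weighted_norm ::
    "(nat \<Rightarrow> real) \<Rightarrow> (real ^ 'n::finite) set \<Rightarrow> (real ^ 'n \<Rightarrow> complex) \<Rightarrow> ennreal" where
  "weighted_norm W K \<phi> = (SUP x\<in>K. SUP \<alpha>. ennreal (cmod (multi_deriv \<alpha> \<phi> x) / W (mi_order \<alpha>)))"

definition E_beurling ::
    "(nat \<Rightarrow> real) \<Rightarrow> (real ^ 'n::finite) set \<Rightarrow> (real ^ 'n \<Rightarrow> complex) set" where
  "E_beurling M \<Omega> =
     {\<phi> \<in> C_infinity \<Omega>. \<forall>K h. regular_compact_in K \<Omega> \<and> 0 < h \<longrightarrow>
        weighted_norm (beurling_weight M h) K \<phi> < \<infinity>}"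

definition E_roumieu ::
    "(nat \<Rightarrow> real) \<Rightarrow> (real ^ 'n::finite) set \<Rightarrow> (real ^ 'n \<Rightarrow> complex) set" where
  "E_roumieu M \<Omega> =
     {\<phi> \<in> C_infinity \<Omega>. \<forall>K r. regular_compact_in K \<Omega> \<and> r \<in> seqs_R \<longrightarrow>
        weighted_norm (roumieu_weight M r) K \<phi> < \<infinity>}"

definition D_beurling ::
    "(nat \<Rightarrow> real) \<Rightarrow> (real ^ 'n::finite) set \<Rightarrow> real \<Rightarrow> (real ^ 'n) set \<Rightarrow> (real ^ 'n \<Rightarrow> complex) set"
  where
  "D_beurling M \<Omega> h K =
     {\<phi> \<in> C_infinity \<Omega>. supp \<Omega> \<phi> \<subseteq> K \<and> weighted_norm (beurling_weight M h) K \<phi> < \<infinity>}"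

definition D_roumieu ::
    "(nat \<Rightarrow> real) \<Rightarrow> (real ^ 'n::finite) set \<Rightarrow> (nat \<Rightarrow> real) \<Rightarrow> (real ^ 'n) set
      \<Rightarrow> (real ^ 'n \<Rightarrow> complex) set"
  where
  "D_roumieu M \<Omega> r K =
     {\<phi> \<in> C_infinity \<Omega>. supp \<Omega> \<phi> \<subseteq> K \<and> weighted_norm (roumieu_weight M r) K \<phi> < \<infinity>}"


section \<open>Generalized ultradistributions\<close>

text \<open>Nets are functions of a real parameter of which only the values on \<open>{0<..<1}\<close> matter.\<close>

definition net_bigo :: "(real \<Rightarrow> ennreal) \<Rightarrow> (real \<Rightarrow> real) \<Rightarrow> bool" where
  "net_bigo a b \<longleftrightarrow>
     (\<exists>C>0. \<exists>\<epsilon>\<^sub>0\<in>{0<..<1}. \<forall>\<epsilon>\<in>{0<..<\<epsilon>\<^sub>0}. a \<epsilon> \<le> ennreal (C * b \<epsilon>))"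

type_synonym 'n net = "real \<Rightarrow> real ^ 'n \<Rightarrow> complex"

definition EM_beurling :: "(nat \<Rightarrow> real) \<Rightarrow> (real ^ 'n::finite) set \<Rightarrow> 'n net set" where
  "EM_beurling M \<Omega> =
     {g. (\<forall>\<epsilon>\<in>{0<..<1}. g \<epsilon> \<in> E_beurling M \<Omega>) \<and>
         (\<forall>K h. regular_compact_in K \<Omega> \<and> 0 < h \<longrightarrow>
            (\<exists>k\<ge>0. net_bigo (\<lambda>\<epsilon>. weighted_norm (beurling_weight M h) K (g \<epsilon>))
                            (\<lambda>\<epsilon>. exp (assoc_fun M (k / \<epsilon>)))))}"

definition N_beurling :: "(nat \<Rightarrow> real) \<Rightarrow> (real ^ 'n::finite) set \<Rightarrow> 'n net set" where
  "N_beurling M \<Omega> =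
     {g. (\<forall>\<epsilon>\<in>{0<..<1}. g \<epsilon> \<in> E_beurling M \<Omega>) \<and>
         (\<forall>K h k. regular_compact_in K \<Omega> \<and> 0 < h \<and> 0 \<le> k \<longrightarrow>
            net_bigo (\<lambda>\<epsilon>. weighted_norm (beurling_weight M h) K (g \<epsilon>))
                     (\<lambda>\<epsilon>. exp (- assoc_fun M (k / \<epsilon>))))}"

definition EM_roumieu :: "(nat \<Rightarrow> real) \<Rightarrow> (real ^ 'n::finite) set \<Rightarrow> 'n net set" where
  "EM_roumieu M \<Omega> =
     {g. (\<forall>\<epsilon>\<in>{0<..<1}. g \<epsilon> \<in> E_roumieu M \<Omega>) \<and>
         (\<forall>K h. regular_compact_in K \<Omega> \<and> h \<in> seqs_R \<longrightarrow>
            (\<exists>k\<in>seqs_R. net_bigo (\<lambda>\<epsilon>. weighted_norm (roumieu_weight M h) K (g \<epsilon>))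
                                 (\<lambda>\<epsilon>. exp (assoc_fun_R M k (1 / \<epsilon>)))))}"

definition N_roumieu :: "(nat \<Rightarrow> real) \<Rightarrow> (real ^ 'n::finite) set \<Rightarrow> 'n net set" where
  "N_roumieu M \<Omega> =
     {g. (\<forall>\<epsilon>\<in>{0<..<1}. g \<epsilon> \<in> E_roumieu M \<Omega>) \<and>
         (\<forall>K h k. regular_compact_in K \<Omega> \<and> h \<in> seqs_R \<and> k \<in> seqs_R \<longrightarrow>
            net_bigo (\<lambda>\<epsilon>. weighted_norm (roumieu_weight M h) K (g \<epsilon>))
                     (\<lambda>\<epsilon>. exp (- assoc_fun_R M k (1 / \<epsilon>))))}"

definition net_rel :: "'n net set \<Rightarrow> 'n net set \<Rightarrow> ('n::finite net \<times> 'n net) set" where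
  "net_rel E N = {(f, g). f \<in> E \<and> g \<in> E \<and> (\<lambda>\<epsilon> x. f \<epsilon> x - g \<epsilon> x) \<in> N}"

definition rel_beurling ::
    "(nat \<Rightarrow> real) \<Rightarrow> (real ^ 'n::finite) set \<Rightarrow> ('n net \<times> 'n net) set" where
  "rel_beurling M \<Omega> = net_rel (EM_beurling M \<Omega>) (N_beurling M \<Omega>)"

definition rel_roumieu ::
    "(nat \<Rightarrow> real) \<Rightarrow> (real ^ 'n::finite) set \<Rightarrow> ('n net \<times> 'n net) set" where
  "rel_roumieu M \<Omega> = net_rel (EM_roumieu M \<Omega>) (N_roumieu M \<Omega>)"

definition G_beurling :: "(nat \<Rightarrow> real) \<Rightarrow> (real ^ 'n::finite) set \<Rightarrow> 'n net set set" where
  "G_beurling M \<Omega> = EM_beurling M \<Omega> // rel_beurling M \<Omega>"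

definition G_roumieu :: "(nat \<Rightarrow> real) \<Rightarrow> (real ^ 'n::finite) set \<Rightarrow> 'n net set set" where
  "G_roumieu M \<Omega> = EM_roumieu M \<Omega> // rel_roumieu M \<Omega>"

definition class_beurling ::
    "(nat \<Rightarrow> real) \<Rightarrow> (real ^ 'n::finite) set \<Rightarrow> 'n net \<Rightarrow> 'n net set" where
  "class_beurling M \<Omega> f = rel_beurling M \<Omega> `` {f}"

definition class_roumieu ::
    "(nat \<Rightarrow> real) \<Rightarrow> (real ^ 'n::finite) set \<Rightarrow> 'n net \<Rightarrow> 'n net set" where
  "class_roumieu M \<Omega> f = rel_roumieu M \<Omega> `` {f}"

definition zero_beurling :: "(nat \<Rightarrow> real) \<Rightarrow> (real ^ 'n::finite) set \<Rightarrow> 'n net set" where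
  "zero_beurling M \<Omega> = class_beurling M \<Omega> (\<lambda>\<epsilon> x. 0)"

definition zero_roumieu :: "(nat \<Rightarrow> real) \<Rightarrow> (real ^ 'n::finite) set \<Rightarrow> 'n net set" where
  "zero_roumieu M \<Omega> = class_roumieu M \<Omega> (\<lambda>\<epsilon> x. 0)"

definition NC_beurling :: "(nat \<Rightarrow> real) \<Rightarrow> (real \<Rightarrow> complex) set" where
  "NC_beurling M =
     {c. \<forall>k>0. net_bigo (\<lambda>\<epsilon>. ennreal (cmod (c \<epsilon>))) (\<lambda>\<epsilon>. exp (- assoc_fun M (k / \<epsilon>)))}"

definition NC_roumieu :: "(nat \<Rightarrow> real) \<Rightarrow> (real \<Rightarrow> complex) set" where
  "NC_roumieu M =
     {c. \<forall>k\<in>seqs_R. net_bigo (\<lambda>\<epsilon>. ennreal (cmod (c \<epsilon>))) (\<lambda>\<epsilon>. exp (- assoc_fun_R M k (1 / \<epsilon>)))}"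

end

theory Submission
  imports Defs
begin

text \<open>
  Both cases are instances of one statement about a class of weights closed under minima and under
  passing from \<open>W\<close> to some \<open>U\<close> with \<open>U (p + q) \<le> C * W p * W q\<close>, which is how (M.2) enters; since
  \<open>M(k/\<epsilon>)\<close> is the associated function of \<open>k\<^sup>-\<^sup>p M\<^sub>p\<close> at \<open>1/\<epsilon>\<close>, the Beurling case fits this pattern.
  By uniform boundedness, the pairing with \<open>f\<^sub>\<epsilon>\<close> is negligible uniformly on the unit ball
  of the test space. The functions \<open>cnj (\<partial>\<^sup>2\<^sup>\<alpha> f\<^sub>\<epsilon>)\<close> are themselves test functions, with moderate norm,
  and pairing with them gives \<open>\<integral>|\<partial>\<^sup>\<alpha> f\<^sub>\<epsilon>|\<^sup>2\<close> after integrating by parts. A function with Lipschitz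
  constant \<open>L\<close> and value \<open>a\<close> at some point is at least \<open>a/2\<close> on a ball of radius \<open>a/(2L)\<close>, so these
  \<open>L\<^sup>2\<close> bounds turn into bounds for the suprema.
\<close>

section \<open>Partial derivatives of smooth functions\<close>

text \<open>The functions paired with \<open>f \<epsilon>\<close> vary with epsilon, whereas the
  hypothesis concerns one fixed test function at a time, with a constant and a threshold that may
  depend on it; hence the need for uniform boundedness. The hypothesis is also given for a single
  weight, while negligibility is asked for every weight W. The moderate bound is therefore taken for
  a weight split twice, so that derivatives falling on the test function are measured by the given
  weight and the derivatives of order 2 alpha by the target weight. With d the dimension, passing
  from L2 to suprema reads sup^(d+2) <= const * L^d * (L2 norm)^2. At derivative order p, L has size
  F * W p and the squared L2 norm has size F * e * (W p)^2, where F is the moderate growth of f and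
  e the scale of the pairing. So W p occurs d+2 times and the root returns exactly the target
  weight, uniformly in p. The d+1 factors F are harmless because e can be chosen after F: a
  negligible net lies below every scale.\<close>

lemma mixed_difference_mvt:
  fixes u :: "'a::real_normed_vector \<Rightarrow> real"
  assumes ua: "\<And>y. ((\<lambda>t. u (y + t *\<^sub>R a)) has_real_derivative ua y) (at 0)"
    and uab: "\<And>y. ((\<lambda>t. ua (y + t *\<^sub>R b)) has_real_derivative uab y) (at 0)"
    and "0 < t"
  shows "\<exists>r s. 0 < r \<and> r < t \<and> 0 < s \<and> s < t \<and>
    u (x + t *\<^sub>R a + t *\<^sub>R b) - u (x + t *\<^sub>R a) - u (x + t *\<^sub>R b) + u x
      = t\<^sup>2 * uab (x + r *\<^sub>R a + s *\<^sub>R b)"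
proof -
  have da: "((\<lambda>t. u (y + t *\<^sub>R a)) has_real_derivative ua (y + r *\<^sub>R a)) (at r)" for y r
    using ua[of "y + r *\<^sub>R a"] DERIV_shift[of "\<lambda>t. u (y + t *\<^sub>R a)" "ua (y + r *\<^sub>R a)" 0 r]
    by (simp add: algebra_simps)
  have db: "((\<lambda>t. ua (y + t *\<^sub>R b)) has_real_derivative uab (y + r *\<^sub>R b)) (at r)" for y r
    using uab[of "y + r *\<^sub>R b"] DERIV_shift[of "\<lambda>t. ua (y + t *\<^sub>R b)" "uab (y + r *\<^sub>R b)" 0 r]
    by (simp add: algebra_simps)
  \<comment> \<open>\<open>g\<close> is the increment along \<open>b\<close> as a function of the
    displacement along \<open>a\<close>. The mean value theorem is applied once to \<open>g\<close>
    and once to \<open>ua\<close> along \<open>b\<close>.\<close>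
  define g where "g r = u (x + t *\<^sub>R b + r *\<^sub>R a) - u (x + r *\<^sub>R a)" for r
  have "(g has_real_derivative (ua (x + t *\<^sub>R b + r *\<^sub>R a) - ua (x + r *\<^sub>R a))) (at r)" for r
    unfolding g_def by (intro DERIV_diff da)
  from MVT2[OF \<open>0 < t\<close> this] obtain r where r: "0 < r" "r < t"
    and gr: "g t - g 0 = t * (ua (x + t *\<^sub>R b + r *\<^sub>R a) - ua (x + r *\<^sub>R a))"
    by auto
  from MVT2[OF \<open>0 < t\<close> db[of "x + r *\<^sub>R a"]] obtain s where s: "0 < s" "s < t"
    and "ua (x + r *\<^sub>R a + t *\<^sub>R b) - ua (x + r *\<^sub>R a) = t * uab (x + r *\<^sub>R a + s *\<^sub>R b)"
    by auto
  then have "ua (x + t *\<^sub>R b + r *\<^sub>R a) - ua (x + r *\<^sub>R a) = t * uab (x + r *\<^sub>R a + s *\<^sub>R b)"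
    by (simp add: add_ac)
  with gr have "g t - g 0 = t\<^sup>2 * uab (x + r *\<^sub>R a + s *\<^sub>R b)"
    by (simp add: power2_eq_square)
  moreover have "g t - g 0
      = u (x + t *\<^sub>R a + t *\<^sub>R b) - u (x + t *\<^sub>R a) - u (x + t *\<^sub>R b) + u x"
    by (simp add: g_def add_ac)
  ultimately show ?thesis
    using r s by (intro exI[of _ r] exI[of _ s]) simp
qed

text \<open>Schwarz's theorem: the second difference is symmetric in \<open>a\<close> and
  \<open>b\<close>, so it is t^2 times a value of either mixed derivative near \<open>x\<close>.
  After cancelling t^2, continuity at \<open>x\<close> identifies the limits. Values are real
  because the mean value theorem fails for complex ones; complex functions are treated through
  \<open>Re\<close> and \<open>Im\<close>.\<close>

lemma mixed_derivatives_commute: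
  fixes u :: "'a::real_normed_vector \<Rightarrow> real"
  assumes ua: "\<And>y. ((\<lambda>t. u (y + t *\<^sub>R a)) has_real_derivative ua y) (at 0)"
    and uab: "\<And>y. ((\<lambda>t. ua (y + t *\<^sub>R b)) has_real_derivative uab y) (at 0)"
    and ub: "\<And>y. ((\<lambda>t. u (y + t *\<^sub>R b)) has_real_derivative ub y) (at 0)"
    and uba: "\<And>y. ((\<lambda>t. ub (y + t *\<^sub>R a)) has_real_derivative uba y) (at 0)"
    and cont: "isCont uab x" "isCont uba x"
  shows "uab x = uba x"
proof -
  define t where "t n = inverse (real (Suc n))" for n
  have t: "0 < t n" for n by (simp add: t_def)
  have t0: "t \<longlonglongrightarrow> 0"
    unfolding t_def by (rule LIMSEQ_inverse_real_of_nat)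
  have "\<forall>n. \<exists>r s. 0 < r \<and> r < t n \<and> 0 < s \<and> s < t n \<and>
    u (x + t n *\<^sub>R a + t n *\<^sub>R b) - u (x + t n *\<^sub>R a) - u (x + t n *\<^sub>R b) + u x
      = (t n)\<^sup>2 * uab (x + r *\<^sub>R a + s *\<^sub>R b)"
    by (intro allI mixed_difference_mvt[where u=u and ua=ua] ua uab t)
  then obtain r s where rs: "\<And>n. 0 < r n \<and> r n < t n \<and> 0 < s n \<and> s n < t n"
    and 1: "\<And>n. u (x + t n *\<^sub>R a + t n *\<^sub>R b) - u (x + t n *\<^sub>R a) - u (x + t n *\<^sub>R b) + u x
       = (t n)\<^sup>2 * uab (x + r n *\<^sub>R a + s n *\<^sub>R b)"
    unfolding choice_iff by blast
  have "\<forall>n. \<exists>r s. 0 < r \<and> r < t n \<and> 0 < s \<and> s < t n \<and>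
    u (x + t n *\<^sub>R b + t n *\<^sub>R a) - u (x + t n *\<^sub>R b) - u (x + t n *\<^sub>R a) + u x
      = (t n)\<^sup>2 * uba (x + r *\<^sub>R b + s *\<^sub>R a)"
    by (intro allI mixed_difference_mvt[where u=u and ua=ub] ub uba t)
  then obtain r' s' where rs': "\<And>n. 0 < r' n \<and> r' n < t n \<and> 0 < s' n \<and> s' n < t n"
    and 2: "\<And>n. u (x + t n *\<^sub>R b + t n *\<^sub>R a) - u (x + t n *\<^sub>R b) - u (x + t n *\<^sub>R a) + u x
       = (t n)\<^sup>2 * uba (x + r' n *\<^sub>R b + s' n *\<^sub>R a)"
    unfolding choice_iff by blast
  have eq: "uab (x + r n *\<^sub>R a + s n *\<^sub>R b) = uba (x + r' n *\<^sub>R b + s' n *\<^sub>R a)" for n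
  proof -
    have "(t n)\<^sup>2 * uab (x + r n *\<^sub>R a + s n *\<^sub>R b) = (t n)\<^sup>2 * uba (x + r' n *\<^sub>R b + s' n *\<^sub>R a)"
      unfolding 1[of n, symmetric] 2[of n, symmetric] by (simp add: algebra_simps)
    moreover have "(t n)\<^sup>2 \<noteq> 0" using t[of n] by auto
    ultimately show ?thesis by (rule mult_left_cancel[THEN iffD1, rotated])
  qed
  have lim: "q \<longlonglongrightarrow> 0" if "\<And>n. 0 < q n \<and> q n < t n" for q
    by (rule tendsto_sandwich[OF _ _ tendsto_const t0])
      (intro always_eventually allI less_imp_le that[THEN conjunct1] that[THEN conjunct2])+
  have rs_pos: "0 < r n \<and> r n < t n" "0 < s n \<and> s n < t n"
    "0 < r' n \<and> r' n < t n" "0 < s' n \<and> s' n < t n" for n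
    using rs[of n] rs'[of n] by auto
  have "(\<lambda>n. x + r n *\<^sub>R a + s n *\<^sub>R b) \<longlonglongrightarrow> x + 0 *\<^sub>R a + 0 *\<^sub>R b"
    by (intro tendsto_add tendsto_scaleR tendsto_const lim[of r] lim[of s] rs_pos)
  then have A: "(\<lambda>n. uab (x + r n *\<^sub>R a + s n *\<^sub>R b)) \<longlonglongrightarrow> uab x"
    by (intro isCont_tendsto_compose[OF cont(1)]) simp
  have "(\<lambda>n. x + r' n *\<^sub>R b + s' n *\<^sub>R a) \<longlonglongrightarrow> x + 0 *\<^sub>R b + 0 *\<^sub>R a"
    by (intro tendsto_add tendsto_scaleR tendsto_const lim[of r'] lim[of s'] rs_pos)
  then have "(\<lambda>n. uba (x + r' n *\<^sub>R b + s' n *\<^sub>R a)) \<longlonglongrightarrow> uba x"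
    by (intro isCont_tendsto_compose[OF cont(2)]) simp
  with A show ?thesis unfolding eq by (rule LIMSEQ_unique)
qed

section \<open>Smooth functions on the whole space and the order of differentiation\<close>

definition smooth :: "(real ^ 'n::finite \<Rightarrow> complex) \<Rightarrow> bool" where
  "smooth u \<longleftrightarrow> (\<forall>is x. partials is u differentiable (at x))"

lemma partials_Nil [simp]: "partials [] u = u"
  and partials_Cons [simp]: "partials (i # is) u = partial i (partials is u)"
  by (simp_all add: partials_def)

lemma partials_append: "partials (is @ js) u = partials is (partials js u)"
  by (simp add: partials_def)

lemma smoothD: "smooth u \<Longrightarrow> u differentiable (at x)"
  unfolding smooth_def by (metis partials_Nil)

lemma smooth_partials: "smooth u \<Longrightarrow> smooth (partials is u)"
  unfolding smooth_def by (metis partials_append)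

lemma smooth_partial: "smooth u \<Longrightarrow> smooth (partial i u)"
  using smooth_partials[of u "[i]"] by simp

lemma smooth_has_derivative:
  assumes "smooth u"
  shows "(u has_derivative (\<lambda>h. \<Sum>i\<in>UNIV. (h $ i) *\<^sub>R partial i u x)) (at x)"
proof -
  have *: "(u has_derivative frechet_derivative u (at x)) (at x)"
    using smoothD[OF assms] by (simp add: frechet_derivative_works)
  then interpret bounded_linear "frechet_derivative u (at x)"
    by (rule has_derivative_bounded_linear)
  have "frechet_derivative u (at x) h = (\<Sum>i\<in>UNIV. (h $ i) *\<^sub>R partial i u x)" for h
  proof -
    have "h = (\<Sum>i\<in>UNIV. (h $ i) *\<^sub>R axis i 1)"
      by (simp add: vec_eq_iff axis_def if_distrib cong: if_cong)
    then have "frechet_derivative u (at x) h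
        = frechet_derivative u (at x) (\<Sum>i\<in>UNIV. (h $ i) *\<^sub>R axis i 1)"
      by simp
    then show ?thesis
      by (simp add: sum scaleR partial_def)
  qed
  then have "frechet_derivative u (at x) = (\<lambda>h. \<Sum>i\<in>UNIV. (h $ i) *\<^sub>R partial i u x)"
    by (rule ext)
  with * show ?thesis by simp
qed

lemma partial_eqI:
  assumes "(u has_derivative D) (at x)"
  shows "partial i u x = D (axis i 1)"
  using frechet_derivative_at[OF assms] by (simp add: partial_def)

lemma smooth_continuous_on: "smooth u \<Longrightarrow> continuous_on S u"
  by (intro differentiable_imp_continuous_on) (auto simp: differentiable_on_def smoothD intro: differentiable_at_withinI)

lemma smooth_isCont: "smooth u \<Longrightarrow> isCont u x"
  using smooth_continuous_on[of u UNIV] by (simp add: continuous_on_eq_continuous_at)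

lemma smooth_directional_derivative:
  assumes "smooth u"
  shows "((\<lambda>t. u (x + t *\<^sub>R axis i 1)) has_vector_derivative partial i u x) (at 0)"
proof -
  have "(u has_derivative frechet_derivative u (at x)) (at x)"
    using smoothD[OF assms] by (simp add: frechet_derivative_works)
  then have d: "(u has_derivative frechet_derivative u (at x)) (at (x + 0 *\<^sub>R axis i 1))"
    by simp
  have "((\<lambda>t. x + t *\<^sub>R axis i 1) has_derivative (\<lambda>t. t *\<^sub>R axis i 1)) (at (0::real))"
    by (auto intro!: derivative_eq_intros)
  from has_derivative_compose[OF this d]
  have "((\<lambda>t. u (x + t *\<^sub>R axis i 1)) has_derivative (\<lambda>t. frechet_derivative u (at x) (t *\<^sub>R axis i 1))) (at 0)" .
  moreover have "frechet_derivative u (at x) (t *\<^sub>R axis i 1) = t *\<^sub>R partial i u x" for t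
    unfolding partial_def by (rule linear_cmul[OF linear_frechet_derivative[OF smoothD[OF assms]]])
  ultimately show ?thesis
    by (simp add: has_vector_derivative_def)
qed

lemma smooth_Re_Im_derivative:
  assumes "smooth u"
  shows "((\<lambda>t. Re (u (x + t *\<^sub>R axis i 1))) has_real_derivative Re (partial i u x)) (at 0)"
    and "((\<lambda>t. Im (u (x + t *\<^sub>R axis i 1))) has_real_derivative Im (partial i u x)) (at 0)"
  using smooth_directional_derivative[OF assms, of x i]
  by (simp_all add: has_real_derivative_iff_has_vector_derivative has_vector_derivative_complex_iff)

lemma partial_commute:
  assumes "smooth u"
  shows "partial i (partial j u) = partial j (partial i u)"
proof
  fix x
  note s = smooth_Re_Im_derivative[OF assms] smooth_Re_Im_derivative[OF smooth_partial[OF assms]]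
  have c: "isCont (partial i (partial j u)) x" for i j
    by (intro smooth_isCont smooth_partial assms)
  have "Re (partial i (partial j u) x) = Re (partial j (partial i u) x)"
    by (rule mixed_derivatives_commute[of "\<lambda>y. Re (u y)" "axis j 1" "\<lambda>y. Re (partial j u y)"
      "axis i 1" "\<lambda>y. Re (partial i (partial j u) y)" "\<lambda>y. Re (partial i u y)"
      "\<lambda>y. Re (partial j (partial i u) y)"]) (intro s isCont_Re c)+
  moreover have "Im (partial i (partial j u) x) = Im (partial j (partial i u) x)"
    by (rule mixed_derivatives_commute[of "\<lambda>y. Im (u y)" "axis j 1" "\<lambda>y. Im (partial j u y)"
      "axis i 1" "\<lambda>y. Im (partial i (partial j u) y)" "\<lambda>y. Im (partial i u y)"
      "\<lambda>y. Im (partial j (partial i u) y)"]) (intro s isCont_Im c)+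
  ultimately show "partial i (partial j u) x = partial j (partial i u) x"
    by (rule complex_eqI)
qed

text \<open>Needed because \<open>multi_deriv\<close> picks its list by choice.
  \<open>fold_permuted_eq\<close> reduces the claim to commuting two operators on functions with an
  invariant, here \<open>smooth\<close>, which \<open>partial\<close> preserves.\<close>

lemma partials_permute:
  assumes "smooth u" "mset is = mset js"
  shows "partials is u = partials js u"
proof -
  have "fold partial (rev is) u = fold partial (rev js) u"
    by (rule fold_permuted_eq[where P=smooth])
      (use assms in \<open>auto simp: smooth_partial partial_commute\<close>)
  then show ?thesis by (simp add: partials_def foldr_conv_fold)
qed

lemma length_eq_sum_count_list: "length (is :: 'n::finite list) = (\<Sum>i\<in>UNIV. count_list is i)"
proof (induction "is")
  case (Cons a "is")
  have "(\<Sum>i\<in>UNIV. count_list (a # is) i) = (\<Sum>i\<in>UNIV. count_list is i + (if i = a then 1 else 0))"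
    by (intro sum.cong) auto
  then show ?case using Cons by (simp add: sum.distrib)
qed simp

text \<open>Allows multi-indices to be replaced by lists: lists concatenate and their lengths add,
  which is what the splitting of weights at \<open>p + q\<close> acts on.\<close>

lemma partials_eq_multi_deriv:
  assumes "smooth u"
  shows "partials is u = multi_deriv (count_list is) u"
    and "mi_order (count_list is) = length is"
proof -
  define js where "js = (SOME js. \<forall>i. count_list js i = count_list is i)"
  have "\<forall>i. count_list js i = count_list is i"
    unfolding js_def by (rule someI_ex) blast
  then have "mset is = mset js"
    by (simp add: multiset_eq_iff count_mset)
  with assms have "partials is u = partials js u"
    by (rule partials_permute)
  then show "partials is u = multi_deriv (count_list is) u"
    by (simp add: multi_deriv_def js_def)
qed (simp add: mi_order_def length_eq_sum_count_list)

lemma multi_deriv_obtain: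
  obtains "is" where "multi_deriv \<alpha> = partials is" "mi_order \<alpha> = length is"
proof -
  define js where "js = (SOME js. \<forall>i. count_list js i = \<alpha> i)"
  have "\<forall>i. count_list js i = \<alpha> i"
    unfolding js_def by (rule someI_ex[OF multi_index_list_exists])
  then have "mi_order \<alpha> = length js" by (simp add: mi_order_def length_eq_sum_count_list)
  moreover have "multi_deriv \<alpha> = partials js" by (simp add: fun_eq_iff multi_deriv_def js_def)
  ultimately show ?thesis using that by blast
qed

lemma has_derivative_partial_UNIV:
  fixes u :: "real ^ 'n::finite \<Rightarrow> complex"
  shows "smooth u \<Longrightarrow> (u has_derivative (\<lambda>h. \<Sum>i\<in>UNIV. (h $ i) *\<^sub>R partial i u x)) (at x within S)"
  by (rule has_derivative_at_withinI[OF smooth_has_derivative])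

lemma partials_bounded_linear:
  assumes "smooth u" "bounded_linear L"
  shows "partials is (\<lambda>x. L (u x)) = (\<lambda>x. L (partials is u x))"
proof (induction "is")
  case (Cons i "is")
  have "partial i (\<lambda>x. L (partials is u x)) x = L (partial i (partials is u) x)" for x
  proof -
    have "(partials is u has_derivative frechet_derivative (partials is u) (at x)) (at x)"
      using assms(1) by (simp add: smooth_def frechet_derivative_works)
    from bounded_linear.has_derivative[OF assms(2) this] show ?thesis
      by (subst partial_eqI) (simp_all add: partial_def)
  qed
  then show ?case by (simp add: Cons.IH)
qed simp

lemma smooth_bounded_linear:
  assumes "smooth u" "bounded_linear L"
  shows "smooth (\<lambda>x. L (u x))"
  unfolding smooth_def partials_bounded_linear[OF assms]
  using assms(1) unfolding smooth_def differentiable_def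
  by (blast intro: bounded_linear.has_derivative[OF assms(2)])

lemma partials_diff:
  assumes "open \<Omega>"
    and u: "\<And>is x. x \<in> \<Omega> \<Longrightarrow> partials is u differentiable (at x)"
    and v: "\<And>is x. x \<in> \<Omega> \<Longrightarrow> partials is v differentiable (at x)"
    and "x \<in> \<Omega>"
  shows "partials is (\<lambda>x. u x - v x) x = partials is u x - partials is v x"
    and "partials is (\<lambda>x. u x - v x) differentiable (at x)"
proof -
  \<comment> \<open>An equality can be differentiated only if it holds on an open set, so
    \<open>D\<close> takes it as a premise on all of \<open>\<Omega>\<close>. The induction for
    \<open>eq\<close> feeds its hypothesis into \<open>D\<close>; afterwards \<open>D\<close> yields
    differentiability.\<close>
  have D: "(partials is (\<lambda>x. u x - v x) has_derivative
      (\<lambda>h. frechet_derivative (partials is u) (at x) h - frechet_derivative (partials is v) (at x) h)) (at x)"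
    if "\<And>x. x \<in> \<Omega> \<Longrightarrow> partials is (\<lambda>x. u x - v x) x = partials is u x - partials is v x" "x \<in> \<Omega>"
    for "is" x
  proof (rule has_derivative_transform_within_open)
    show "((\<lambda>x. partials is u x - partials is v x) has_derivative
      (\<lambda>h. frechet_derivative (partials is u) (at x) h - frechet_derivative (partials is v) (at x) h)) (at x)"
      using u[OF that(2)] v[OF that(2)]
      by (intro has_derivative_diff) (simp_all add: frechet_derivative_works[symmetric])
  qed (use that \<open>open \<Omega>\<close> in auto)
  have eq: "partials is (\<lambda>x. u x - v x) x = partials is u x - partials is v x" if "x \<in> \<Omega>" for "is" x
    using that
  proof (induction "is" arbitrary: x)
    case (Cons i "is")
    from partial_eqI[OF D[OF Cons.IH Cons.prems]] show ?case
      by (simp add: partial_def)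
  qed simp
  from eq \<open>x \<in> \<Omega>\<close> show "partials is (\<lambda>x. u x - v x) x = partials is u x - partials is v x" .
  from D[OF eq \<open>x \<in> \<Omega>\<close>] show "partials is (\<lambda>x. u x - v x) differentiable (at x)"
    by (rule differentiableI)
qed

lemma smooth_diff: "smooth u \<Longrightarrow> smooth v \<Longrightarrow> smooth (\<lambda>x. u x - v x)"
  using partials_diff(2)[of UNIV u v] by (simp add: smooth_def)

lemma partials_zero_outside:
  assumes "closed K" "\<And>x. x \<notin> K \<Longrightarrow> u x = 0" "x \<notin> K"
  shows "partials is u x = 0"
  using \<open>x \<notin> K\<close>
proof (induction "is" arbitrary: x)
  case (Cons i "is")
  have "(partials is u has_derivative (\<lambda>_. 0)) (at x)"
    by (rule has_derivative_transform_within_open[of "\<lambda>_. 0" _ _ _ "- K"])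
      (use Cons assms(1) in \<open>auto simp: open_Compl\<close>)
  then show ?case by (simp add: partial_eqI)
qed (use assms in simp)

lemma smooth_Lipschitz:
  fixes u :: "real ^ 'n::finite \<Rightarrow> complex"
  assumes "smooth u" "\<And>i x. cmod (partial i u x) \<le> B"
  shows "cmod (u x - u y) \<le> real CARD('n) * B * norm (x - y)"
proof (rule differentiable_bound[OF convex_UNIV has_derivative_partial_UNIV[OF assms(1)]])
  fix x
  show "onorm (\<lambda>h. \<Sum>i\<in>UNIV. (h $ i) *\<^sub>R partial i u x) \<le> real CARD('n) * B"
  proof (rule onorm_le)
    fix h :: "real ^ 'n"
    have "cmod (\<Sum>i\<in>UNIV. (h $ i) *\<^sub>R partial i u x) \<le> (\<Sum>i\<in>(UNIV::'n set). norm h * B)"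
      by (intro sum_norm_le) (auto intro!: mult_mono assms(2) component_le_norm_cart)
    then show "cmod (\<Sum>i\<in>UNIV. (h $ i) *\<^sub>R partial i u x) \<le> real CARD('n) * B * norm h"
      by (simp add: mult_ac)
  qed
qed auto

definition deriv_bound :: "(nat \<Rightarrow> real) \<Rightarrow> real \<Rightarrow> (real ^ 'n::finite \<Rightarrow> complex) \<Rightarrow> bool" where
  "deriv_bound W B u \<longleftrightarrow> (\<forall>is x. cmod (partials is u x) \<le> B * W (length is))"

lemma deriv_boundD: "deriv_bound W B u \<Longrightarrow> cmod (partials is u x) \<le> B * W (length is)"
  by (simp add: deriv_bound_def)

text \<open>For closed \<open>K\<close> inside an open \<open>\<Omega>\<close> this amounts to
  membership in \<open>C_infinity \<Omega>\<close> with support in \<open>K\<close>, but it does not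
  mention \<open>\<Omega>\<close>.\<close>

definition test_fun :: "(real ^ 'n::finite) set \<Rightarrow> (real ^ 'n \<Rightarrow> complex) \<Rightarrow> bool" where
  "test_fun K u \<longleftrightarrow> smooth u \<and> (\<forall>x. x \<notin> K \<longrightarrow> u x = 0)"

lemma test_fun_smooth: "test_fun K u \<Longrightarrow> smooth u"
  by (simp add: test_fun_def)

lemma test_fun_partials: "closed K \<Longrightarrow> test_fun K u \<Longrightarrow> test_fun K (partials is u)"
  by (auto simp: test_fun_def smooth_partials intro: partials_zero_outside)

lemma test_fun_partial: "closed K \<Longrightarrow> test_fun K u \<Longrightarrow> test_fun K (partial i u)"
  using test_fun_partials[of K u "[i]"] by simp

lemma test_fun_scale:
  fixes c :: complex
  shows "test_fun K u \<Longrightarrow> test_fun K (\<lambda>x. c * u x)"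
  by (simp add: test_fun_def smooth_bounded_linear bounded_linear_mult_right)

lemma deriv_bound_scale:
  fixes c :: complex
  assumes "smooth u" "deriv_bound W B u" "cmod c * B \<le> B'" "\<And>p. 0 < W p"
  shows "deriv_bound W B' (\<lambda>x. c * u x)"
  unfolding deriv_bound_def partials_bounded_linear[OF assms(1) bounded_linear_mult_right]
proof (intro allI)
  fix "is" x
  have "cmod (c * partials is u x) \<le> cmod c * (B * W (length is))"
    unfolding norm_mult by (intro mult_left_mono deriv_boundD assms) auto
  also have "\<dots> = cmod c * B * W (length is)" by simp
  also have "\<dots> \<le> B' * W (length is)"
    by (intro mult_right_mono assms less_imp_le)
  finally show "cmod (c * partials is u x) \<le> B' * W (length is)" .
qed

lemma test_fun_cnj: "test_fun K u \<Longrightarrow> test_fun K (\<lambda>x. cnj (u x))"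
  by (simp add: test_fun_def smooth_bounded_linear bounded_linear_cnj)

lemma partials_cnj: "smooth u \<Longrightarrow> partials is (\<lambda>x. cnj (u x)) x = cnj (partials is u x)"
  by (simp add: partials_bounded_linear bounded_linear_cnj)

section \<open>Termwise differentiation and completeness of the test space\<close>

lemma series_has_derivative:
  fixes w :: "nat \<Rightarrow> real ^ 'n::finite \<Rightarrow> complex" and c :: "nat \<Rightarrow> complex"
  assumes sm: "\<And>n. smooth (w n)"
    and w: "\<And>n x. cmod (w n x) \<le> B"
    and dw: "\<And>n i x. cmod (partial i (w n) x) \<le> B'"
    and c: "summable (\<lambda>n. cmod (c n))"
  shows "((\<lambda>x. \<Sum>n. c n * w n x) has_derivative
      (\<lambda>h. \<Sum>i\<in>UNIV. (h $ i) *\<^sub>R (\<Sum>n. c n * partial i (w n) x))) (at x)"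
proof -
  have sum0: "summable (\<lambda>n. c n * w n x)" for x
    by (rule summable_comparison_test'[OF summable_mult2[OF c, of B], of 0])
      (simp add: norm_mult mult_left_mono w)
  have sum1: "summable (\<lambda>n. c n * partial i (w n) x)" for i x
    by (rule summable_comparison_test'[OF summable_mult2[OF c, of B'], of 0])
      (simp add: norm_mult mult_left_mono dw)
  define D where "D n x h = (\<Sum>i\<in>UNIV. (h $ i) *\<^sub>R (c n * partial i (w n) x))" for n x and h :: "real ^ 'n"
  define D' where "D' x h = (\<Sum>i\<in>UNIV. (h $ i) *\<^sub>R (\<Sum>n. c n * partial i (w n) x))" for x and h :: "real ^ 'n"
  have D: "((\<lambda>x. c n * w n x) has_derivative D n x) (at x within UNIV)" for n x
  proof -
    have "((\<lambda>x. c n * w n x) has_derivative (\<lambda>h. c n * (\<Sum>i\<in>UNIV. (h $ i) *\<^sub>R partial i (w n) x))) (at x within UNIV)"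
      by (intro has_derivative_mult_right has_derivative_partial_UNIV sm)
    moreover have "(\<lambda>h. c n * (\<Sum>i\<in>UNIV. (h $ i) *\<^sub>R partial i (w n) x)) = D n x"
      by (simp add: D_def sum_distrib_left mult_ac fun_eq_iff)
    ultimately show ?thesis by simp
  qed
  have conv: "\<forall>\<^sub>F n in sequentially. \<forall>x\<in>UNIV. \<forall>h. norm ((\<Sum>j<n. D j x h) - D' x h) \<le> e * norm h"
    if "0 < e" for e
  proof -
    \<comment> \<open>The M-test treats one coordinate at a time. Finitely many coordinates share a
      threshold, and the share \<open>e / CARD('n)\<close> makes the coordinate errors add up to
      \<open>e\<close>.\<close>
    have ul: "uniform_limit UNIV (\<lambda>n x. \<Sum>j<n. c j * partial i (w j) x) (\<lambda>x. \<Sum>n. c n * partial i (w n) x) sequentially" for i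
      by (rule Weierstrass_m_test[where M="\<lambda>n. cmod (c n) * B'"])
        (auto simp: norm_mult intro!: mult_left_mono dw summable_mult2 c)
    have "\<forall>\<^sub>F n in sequentially. \<forall>i. \<forall>x\<in>UNIV.
        dist (\<Sum>j<n. c j * partial i (w j) x) (\<Sum>n. c n * partial i (w n) x) < e / CARD('n)"
      using ul \<open>0 < e\<close> by (intro eventually_all_finite uniform_limitD) auto
    then show ?thesis
    proof eventually_elim
      case (elim n)
      show ?case
      proof (intro ballI allI)
        fix x and h :: "real ^ 'n"
        have "(\<Sum>j<n. D j x h) - D' x h
            = (\<Sum>i\<in>UNIV. (h $ i) *\<^sub>R ((\<Sum>j<n. c j * partial i (w j) x) - (\<Sum>n. c n * partial i (w n) x)))"
          unfolding D_def D'_def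
          by (subst sum.swap) (simp add: scaleR_sum_right scaleR_diff_right sum_subtractf)
        also have "norm \<dots> \<le> (\<Sum>i\<in>(UNIV::'n set). norm h * (e / CARD('n)))"
        proof (intro sum_norm_le)
          fix i
          have "norm ((\<Sum>j<n. c j * partial i (w j) x) - (\<Sum>n. c n * partial i (w n) x)) \<le> e / CARD('n)"
            using elim by (simp add: dist_norm less_imp_le)
          then show "norm ((h $ i) *\<^sub>R ((\<Sum>j<n. c j * partial i (w j) x) - (\<Sum>n. c n * partial i (w n) x)))
              \<le> norm h * (e / CARD('n))"
            unfolding norm_scaleR by (intro mult_mono) (auto intro: component_le_norm_cart)
        qed
        finally show "norm ((\<Sum>j<n. D j x h) - D' x h) \<le> e * norm h"
          by (simp add: mult.commute)
      qed
    qed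
  qed
  obtain g where g: "\<And>x. (\<lambda>n. c n * w n x) sums g x" "\<And>x. (g has_derivative D' x) (at x)"
    using has_derivative_series[OF convex_UNIV D conv UNIV_I summable_sums[OF sum0[of x]]] by auto
  then have "(\<lambda>x. \<Sum>n. c n * w n x) = g"
    by (simp add: fun_eq_iff sums_iff)
  with g(2)[of x] show ?thesis
    by (simp add: D'_def[abs_def])
qed

text \<open>Differentiating once more requires a bound for the next derivative.
  \<open>deriv_bound\<close> gives one at each order, uniform in \<open>n\<close>; it may grow with
  the order.\<close>

lemma partials_series:
  fixes v :: "nat \<Rightarrow> real ^ 'n::finite \<Rightarrow> complex" and c :: "nat \<Rightarrow> complex"
  assumes sm: "\<And>n. smooth (v n)"
    and v: "\<And>n. deriv_bound W B (v n)"
    and c: "summable (\<lambda>n. cmod (c n))"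
  shows "partials is (\<lambda>x. \<Sum>n. c n * v n x) = (\<lambda>x. \<Sum>n. c n * partials is (v n) x)"
    and "smooth (\<lambda>x. \<Sum>n. c n * v n x)"
proof -
  have D: "((\<lambda>x. \<Sum>n. c n * partials is (v n) x) has_derivative
      (\<lambda>h. \<Sum>i\<in>UNIV. (h $ i) *\<^sub>R (\<Sum>n. c n * partial i (partials is (v n)) x))) (at x)" for "is" x
  proof (rule series_has_derivative[OF smooth_partials[OF sm] _ _ c])
    show "cmod (partials is (v n) x) \<le> B * W (length is)" for n x
      by (rule deriv_boundD[OF v])
    show "cmod (partial i (partials is (v n)) x) \<le> B * W (Suc (length is))" for n i x
      using deriv_boundD[OF v[of n], of "i # is" x] by simp
  qed
  have eq: "partials is (\<lambda>x. \<Sum>n. c n * v n x) = (\<lambda>x. \<Sum>n. c n * partials is (v n) x)" for "is"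
  proof (induction "is")
    case (Cons i "is")
    have "partial i (\<lambda>x. \<Sum>n. c n * partials is (v n) x) x = (\<Sum>n. c n * partial i (partials is (v n)) x)" for x
    proof -
      have "(\<Sum>j\<in>UNIV. (axis i 1 $ j) *\<^sub>R (\<Sum>n. c n * partial j (partials is (v n)) x))
          = (\<Sum>j\<in>UNIV. if j = i then \<Sum>n. c n * partial j (partials is (v n)) x else 0)"
        by (intro sum.cong) (auto simp: axis_def)
      then show ?thesis
        by (subst partial_eqI[OF D]) simp
    qed
    then show ?case by (simp add: Cons.IH)
  qed simp
  then show "partials is (\<lambda>x. \<Sum>n. c n * v n x) = (\<lambda>x. \<Sum>n. c n * partials is (v n) x)" .
  show "smooth (\<lambda>x. \<Sum>n. c n * v n x)"
    unfolding smooth_def eq using D by (blast intro: differentiableI)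
qed

text \<open>Completeness of the test space in the form needed for uniform boundedness: an absolutely
  convergent series from the unit ball has its sum in the space, with norm at most the sum
  \<open>C\<close> of the majorant. Applied to tails, this makes remainders small.\<close>

lemma test_fun_series:
  fixes v :: "nat \<Rightarrow> real ^ 'n::finite \<Rightarrow> complex" and c :: "nat \<Rightarrow> complex"
  assumes v: "\<And>n. test_fun K (v n)" "\<And>n. deriv_bound W 1 (v n)"
    and c: "\<And>n. cmod (c n) \<le> b n" "b sums C"
    and W: "\<And>p. 0 < W p"
  shows "test_fun K (\<lambda>x. \<Sum>n. c n * v n x)" "deriv_bound W C (\<lambda>x. \<Sum>n. c n * v n x)"
proof -
  have sc: "summable (\<lambda>n. cmod (c n))"
    by (rule summable_comparison_test'[of b 0]) (use c in \<open>auto simp: sums_iff\<close>)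
  note P = partials_series[OF test_fun_smooth[OF v(1)] v(2) sc]
  show "test_fun K (\<lambda>x. \<Sum>n. c n * v n x)"
    using v(1) P(2) by (simp add: test_fun_def)
  show "deriv_bound W C (\<lambda>x. \<Sum>n. c n * v n x)"
    unfolding deriv_bound_def P(1)
  proof (intro allI)
    fix "is" x
    have le: "cmod (c n * partials is (v n) x) \<le> b n * W (length is)" for n
    proof -
      have "0 \<le> b n" using c(1)[of n] by (meson norm_ge_zero order_trans)
      then show ?thesis
        using deriv_boundD[OF v(2)[of n], of "is" x] by (auto simp: norm_mult intro!: mult_mono c(1))
    qed
    have S: "(\<lambda>n. b n * W (length is)) sums (C * W (length is))"
      by (intro sums_mult2 c)
    have "cmod (\<Sum>n. c n * partials is (v n) x) \<le> (\<Sum>n. b n * W (length is))"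
      by (rule norm_suminf_le[OF le]) (use S in \<open>simp add: sums_iff\<close>)
    with S show "cmod (\<Sum>n. c n * partials is (v n) x) \<le> C * W (length is)"
      by (simp add: sums_iff)
  qed
qed

section \<open>Integration by parts\<close>

lemma test_fun_bounded:
  assumes "compact K" "test_fun K u"
  obtains B where "0 < B" "\<And>x. cmod (u x) \<le> B"
proof -
  have "compact (u ` K)"
    using assms by (intro compact_continuous_image smooth_continuous_on test_fun_smooth)
  then obtain B where "0 < B" "\<forall>y\<in>u ` K. cmod y \<le> B"
    using compact_imp_bounded bounded_pos by blast
  moreover have "cmod (u x) \<le> B" for x
    using assms(2) calculation by (cases "x \<in> K") (auto simp: test_fun_def)
  ultimately show ?thesis using that by blast
qed

lemma integrable_zero_outside_compact:
  fixes u :: "'a::euclidean_space \<Rightarrow> 'b::euclidean_space"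
  assumes "compact K" "continuous_on K u" "\<And>x. x \<notin> K \<Longrightarrow> u x = 0"
  shows "integrable lborel u"
proof -
  have "(\<lambda>x. indicator K x *\<^sub>R u x) = u"
    using assms(3) by (auto simp: indicator_def fun_eq_iff)
  then show ?thesis using borel_integrable_compact[OF assms(1,2)] by simp
qed

lemma test_fun_integrable: "compact K \<Longrightarrow> test_fun K u \<Longrightarrow> integrable lborel u"
  by (rule integrable_zero_outside_compact) (auto simp: test_fun_def smooth_continuous_on)

lemma test_fun_integrable_mult:
  "compact K \<Longrightarrow> test_fun K u \<Longrightarrow> smooth v \<Longrightarrow> integrable lborel (\<lambda>x. u x * v x)"
  by (rule integrable_zero_outside_compact[OF _ continuous_on_mult[OF smooth_continuous_on smooth_continuous_on]])
    (auto simp: test_fun_def)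

lemma lborel_integral_translation:
  fixes f :: "'a::euclidean_space \<Rightarrow> 'b::euclidean_space"
  assumes "f \<in> borel_measurable borel"
  shows "(\<integral>x. f (x + a) \<partial>lborel) = (\<integral>x. f x \<partial>lborel)"
proof -
  have "(\<integral>x. f x \<partial>lborel) = (\<integral>x. f x \<partial>(distr lborel borel ((+) a)))"
    by (simp add: lborel_distr_plus)
  also have "\<dots> = (\<integral>x. f (a + x) \<partial>lborel)"
    using assms by (intro integral_distr) auto
  finally show ?thesis by (simp add: add.commute)
qed

text \<open>Each difference quotient of \<open>w\<close> along \<open>a\<close> has integral 0 by
  translation invariance of Lebesgue measure; dominated convergence carries this to the limit
  \<open>dw\<close>.\<close>

lemma integral_eq_zero_if_directional_derivative:
  fixes w :: "'a::euclidean_space \<Rightarrow> 'b::euclidean_space"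
  assumes K: "compact K" "\<And>x. x \<notin> K \<Longrightarrow> w x = 0"
    and cont: "continuous_on UNIV w"
    and L: "\<And>x y. norm (w x - w y) \<le> L * norm (x - y)"
    and d: "\<And>x. ((\<lambda>t. w (x + t *\<^sub>R a)) has_vector_derivative dw x) (at 0)"
    and a: "norm a = 1"
  shows "(\<integral>x. dw x \<partial>lborel) = 0"
proof -
  obtain R where R: "\<And>x. x \<in> K \<Longrightarrow> norm x \<le> R"
    using K(1) compact_imp_bounded bounded_iff by metis
  have "0 \<le> L"
    using L[of a 0] a norm_ge_zero[of "w a - w 0"] by (simp del: norm_ge_zero)
  define t where "t n = inverse (real (Suc n))" for n
  have t: "0 < t n" "t n \<le> 1" for n by (auto simp: t_def field_simps)
  have t0: "t \<longlonglongrightarrow> 0"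
    unfolding t_def by (rule LIMSEQ_inverse_real_of_nat)
  define q where "q n x = (w (x + t n *\<^sub>R a) - w x) /\<^sub>R t n" for n x
  have meas [measurable]: "w \<in> borel_measurable borel"
    by (rule borel_measurable_continuous_onI[OF cont])
  have int_w: "integrable lborel w"
    using K cont by (intro integrable_zero_outside_compact[of K]) (auto intro: continuous_on_subset)
  have qlim: "(\<lambda>n. q n x) \<longlonglongrightarrow> dw x" for x
  proof -
    have "((\<lambda>h. norm (w (x + h *\<^sub>R a) - w x - h *\<^sub>R dw x) / norm h) \<longlongrightarrow> 0) (at 0)"
      using d[of x] by (simp add: has_vector_derivative_def has_derivative_at)
    then have "((\<lambda>h. norm ((w (x + h *\<^sub>R a) - w x) /\<^sub>R h - dw x)) \<longlongrightarrow> 0) (at 0)"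
    proof (rule Lim_transform_eventually)
      show "\<forall>\<^sub>F h in at 0. norm (w (x + h *\<^sub>R a) - w x - h *\<^sub>R dw x) / norm h
          = norm ((w (x + h *\<^sub>R a) - w x) /\<^sub>R h - dw x)"
        unfolding eventually_at_filter
      proof (intro always_eventually allI impI)
        fix h :: real
        assume "h \<noteq> 0"
        then have "(w (x + h *\<^sub>R a) - w x) /\<^sub>R h - dw x = (w (x + h *\<^sub>R a) - w x - h *\<^sub>R dw x) /\<^sub>R h"
          by (simp add: scaleR_diff_right)
        then show "norm (w (x + h *\<^sub>R a) - w x - h *\<^sub>R dw x) / norm h
            = norm ((w (x + h *\<^sub>R a) - w x) /\<^sub>R h - dw x)"
          by (simp add: divide_inverse_commute)
      qed
    qed
    then have "((\<lambda>h. (w (x + h *\<^sub>R a) - w x) /\<^sub>R h) \<longlongrightarrow> dw x) (at 0)"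
      by (simp add: tendsto_norm_zero_iff LIM_zero_iff)
    moreover have "filterlim t (at 0) sequentially"
      using t0 t(1) by (intro filterlim_atI) (auto simp: less_imp_neq[symmetric])
    ultimately show ?thesis
      unfolding q_def by (rule filterlim_compose)
  qed
  have "(\<lambda>n. \<integral>x. q n x \<partial>lborel) \<longlonglongrightarrow> (\<integral>x. dw x \<partial>lborel)"
  proof (rule integral_dominated_convergence)
    show "(\<lambda>x. dw x) \<in> borel_measurable lborel"
    proof (rule borel_measurable_LIMSEQ_metric)
      show "q n \<in> borel_measurable lborel" for n
        unfolding q_def[abs_def] by measurable
    qed (rule qlim)
    \<comment> \<open>Since \<open>a\<close> is a unit vector and \<open>t n\<close> is at most 1,
      translation moves the support by at most 1. So the quotients vanish outside the ball of radius
      \<open>R + 1\<close>, and inside it the Lipschitz constant bounds them.\<close>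
    show "integrable lborel (\<lambda>x. L * indicator (cball 0 (R + 1)) x :: real)"
      by (intro integrable_mult_right integrable_real_indicator emeasure_lborel_cball_finite) auto
    show "AE x in lborel. (\<lambda>n. q n x) \<longlonglongrightarrow> dw x"
      using qlim by simp
    show "AE x in lborel. norm (q n x) \<le> L * indicator (cball 0 (R + 1)) x" for n
    proof (intro always_eventually allI)
      fix x
      show "norm (q n x) \<le> L * indicator (cball 0 (R + 1)) x"
      proof (cases "norm x \<le> R + 1")
        case True
        have "norm (q n x) \<le> (L * t n) / t n"
          using L[of "x + t n *\<^sub>R a" x] a t(1)[of n]
          by (simp add: q_def divide_inverse_commute mult_left_mono)
        then show ?thesis using True t(1)[of n] by simp
      next
        case False
        have "norm x \<le> norm (x + t n *\<^sub>R a) + t n"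
          using norm_triangle_ineq4[of "x + t n *\<^sub>R a" "t n *\<^sub>R a"] a t(1)[of n] by simp
        then have "x + t n *\<^sub>R a \<notin> K" "x \<notin> K"
          using False R[of x] R[of "x + t n *\<^sub>R a"] t(2)[of n] by auto
        then show ?thesis using False K(2) by (simp add: q_def)
      qed
    qed
  qed (simp add: q_def)
  moreover have "(\<integral>x. q n x \<partial>lborel) = 0" for n
  proof -
    have "integrable lborel (\<lambda>x. w (x + t n *\<^sub>R a))"
    proof (rule integrable_zero_outside_compact[of "(\<lambda>x. x - t n *\<^sub>R a) ` K"])
      show "compact ((\<lambda>x. x - t n *\<^sub>R a) ` K)"
        by (intro compact_continuous_image K continuous_intros)
      show "continuous_on ((\<lambda>x. x - t n *\<^sub>R a) ` K) (\<lambda>x. w (x + t n *\<^sub>R a))"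
        by (intro continuous_on_compose2[OF cont] continuous_intros) auto
      show "w (x + t n *\<^sub>R a) = 0" if "x \<notin> (\<lambda>x. x - t n *\<^sub>R a) ` K" for x
        using that by (intro K(2)) (auto simp: image_iff algebra_simps)
    qed
    then show ?thesis
      using int_w by (simp add: q_def lborel_integral_translation)
  qed
  ultimately show ?thesis
    by (simp add: LIMSEQ_const_iff)
qed

lemma test_fun_Lipschitz:
  fixes u :: "real ^ 'n::finite \<Rightarrow> complex"
  assumes K: "compact K" and u: "test_fun K u"
  obtains L where "0 \<le> L" "\<And>x y. cmod (u x - u y) \<le> L * norm (x - y)"
proof -
  have "\<exists>B>0. \<forall>x. cmod (partial i u x) \<le> B" for i
    using test_fun_bounded[OF K test_fun_partial[OF compact_imp_closed[OF K] u]] by metis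
  then obtain B where B: "\<And>i. 0 < B i" "\<And>i x. cmod (partial i u x) \<le> B i" by metis
  have "cmod (partial i u x) \<le> (\<Sum>i\<in>UNIV. B i)" for i x
    using B(2)[of i x] member_le_sum[of i UNIV B] B(1) by (smt (verit) UNIV_I finite_code less_imp_le)
  from smooth_Lipschitz[OF test_fun_smooth[OF u] this] show ?thesis
    using B(1) by (intro that[of "real CARD('n) * (\<Sum>i\<in>UNIV. B i)"] mult_nonneg_nonneg sum_nonneg)
      (auto intro: less_imp_le)
qed

text \<open>The product \<open>u x * v x\<close> is Lipschitz and vanishes off \<open>K\<close>, so
  the integral of its directional derivative is 0; the product rule splits that derivative.\<close>

lemma integration_by_parts:
  fixes u v :: "real ^ 'n::finite \<Rightarrow> complex"
  assumes K: "compact K" and u: "test_fun K u" and v: "test_fun K v"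
  shows "(\<integral>x. partial i u x * v x \<partial>lborel) = - (\<integral>x. u x * partial i v x \<partial>lborel)"
proof -
  obtain A B where A: "0 < A" "\<And>x. cmod (u x) \<le> A" and B: "0 < B" "\<And>x. cmod (v x) \<le> B"
    using test_fun_bounded[OF K u] test_fun_bounded[OF K v] by metis
  obtain L L' where L: "0 \<le> L" "\<And>x y. cmod (u x - u y) \<le> L * norm (x - y)"
    and L': "0 \<le> L'" "\<And>x y. cmod (v x - v y) \<le> L' * norm (x - y)"
    using test_fun_Lipschitz[OF K u] test_fun_Lipschitz[OF K v] by metis
  have "(\<integral>x. u x * partial i v x + partial i u x * v x \<partial>lborel) = 0"
  proof (rule integral_eq_zero_if_directional_derivative[OF K, where w = "\<lambda>x. u x * v x"])
    show "cmod (u x * v x - u y * v y) \<le> (A * L' + B * L) * norm (x - y)" for x y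
    proof -
      have "cmod (u x * v x - u y * v y) = cmod (u x * (v x - v y) + (u x - u y) * v y)"
        by (simp add: algebra_simps)
      also have "\<dots> \<le> cmod (u x) * cmod (v x - v y) + cmod (u x - u y) * cmod (v y)"
        by (rule order_trans[OF norm_triangle_ineq]) (simp add: norm_mult)
      also have "\<dots> \<le> A * (L' * norm (x - y)) + (L * norm (x - y)) * B"
        using A B L L' by (intro add_mono mult_mono) auto
      finally show ?thesis by (simp add: algebra_simps)
    qed
    show "((\<lambda>t. u (x + t *\<^sub>R axis i 1) * v (x + t *\<^sub>R axis i 1)) has_vector_derivative
        u x * partial i v x + partial i u x * v x) (at 0)" for x
      using has_vector_derivative_mult[OF smooth_directional_derivative[OF test_fun_smooth[OF u], of x i]
          smooth_directional_derivative[OF test_fun_smooth[OF v], of x i]] by simp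
    show "continuous_on UNIV (\<lambda>x. u x * v x)"
      by (intro continuous_on_mult[OF smooth_continuous_on smooth_continuous_on] test_fun_smooth[OF u] test_fun_smooth[OF v])
  qed (use u in \<open>auto simp: test_fun_def\<close>)
  moreover have "integrable lborel (\<lambda>x. u x * partial i v x)" "integrable lborel (\<lambda>x. partial i u x * v x)"
    using u v test_fun_partial[OF compact_imp_closed[OF K]]
    by (auto intro!: test_fun_integrable_mult[OF K] smooth_partial test_fun_smooth)
  ultimately show ?thesis
    by (simp add: add_eq_0_iff)
qed

text \<open>The outermost operator on \<open>u\<close> is moved first and so becomes the innermost
  one on \<open>v\<close>, which explains \<open>rev\<close>.\<close>

lemma integral_partials:
  assumes K: "compact K" and u: "test_fun K u" and v: "test_fun K v"
  shows "(\<integral>x. partials is u x * v x \<partial>lborel)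
    = (- 1) ^ length is * (\<integral>x. u x * partials (rev is) v x \<partial>lborel)"
  using v
proof (induction "is" arbitrary: v)
  case (Cons i "is")
  note cl = compact_imp_closed[OF K]
  have "(\<integral>x. partials (i # is) u x * v x \<partial>lborel) = - (\<integral>x. partials is u x * partial i v x \<partial>lborel)"
    using integration_by_parts[OF K test_fun_partials[OF cl u] Cons.prems] by simp
  then show ?case
    using Cons.IH[OF test_fun_partial[OF cl Cons.prems]] by (simp add: partials_append)
qed simp

text \<open>\<open>rev is @ is\<close> is the list form of the multi-index 2 alpha. The modulus on
  the right removes the sign from integrating by parts.\<close>

lemma L2_norm_partials:
  assumes K: "compact K" and u: "test_fun K u"
  shows "(\<integral>x. (cmod (partials is u x))\<^sup>2 \<partial>lborel)
    = cmod (\<integral>x. u x * cnj (partials (rev is @ is) u x) \<partial>lborel)"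
proof -
  have "(\<integral>x. partials is u x * partials is (\<lambda>x. cnj (u x)) x \<partial>lborel)
    = (- 1) ^ length is * (\<integral>x. u x * partials (rev is) (partials is (\<lambda>x. cnj (u x))) x \<partial>lborel)"
    by (rule integral_partials[OF K u test_fun_partials[OF compact_imp_closed[OF K] test_fun_cnj[OF u]]])
  then have "(\<integral>x. of_real ((cmod (partials is u x))\<^sup>2) \<partial>lborel)
    = (- 1) ^ length is * (\<integral>x. u x * cnj (partials (rev is @ is) u x) \<partial>lborel)"
    by (simp add: partials_append[symmetric] partials_cnj test_fun_smooth[OF u] complex_norm_square
      del: of_real_power)
  then have "cmod (of_real (\<integral>x. (cmod (partials is u x))\<^sup>2 \<partial>lborel))
    = cmod (\<integral>x. u x * cnj (partials (rev is @ is) u x) \<partial>lborel)"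
    by (simp add: norm_mult norm_power del: of_real_power)
  then show ?thesis by simp
qed

text \<open>On the ball of radius \<open>a / (2 * L)\<close> the integrand is at least (a/2)^2. Its
  volume contributes the exponent d and the square the exponent 2; \<open>c\<close> collects the
  volume of the unit ball and the d + 2 factors 1/2. The power of \<open>L\<close> stands on the
  right to avoid a division.\<close>

lemma power_sup_le_L2:
  fixes g :: "real ^ 'n::finite \<Rightarrow> complex"
  assumes K: "compact K" and g: "test_fun K g" and "0 < L"
    and L: "\<And>x y. cmod (g x - g y) \<le> L * norm (x - y)"
  defines "c \<equiv> measure lborel (ball (0::real ^ 'n) 1) / 2 ^ (CARD('n) + 2)"
  shows "c * cmod (g x) ^ (CARD('n) + 2) \<le> L ^ CARD('n) * (\<integral>x. (cmod (g x))\<^sup>2 \<partial>lborel)"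
proof (cases "g x = 0")
  case False
  define a where "a = cmod (g x)"
  define r where "r = a / (2 * L)"
  have "0 < a" "0 < r" using False \<open>0 < L\<close> by (auto simp: a_def r_def)
  have int: "integrable lborel (\<lambda>x. (cmod (g x))\<^sup>2)"
    using g by (intro integrable_zero_outside_compact[OF K])
      (auto simp: test_fun_def intro!: continuous_intros smooth_continuous_on)
  have "measure lborel (ball x r) * (a / 2)\<^sup>2 = (\<integral>y. indicator (ball x r) y * (a / 2)\<^sup>2 \<partial>lborel)"
    by simp
  also have "\<dots> \<le> (\<integral>x. (cmod (g x))\<^sup>2 \<partial>lborel)"
  proof (rule integral_mono[OF _ int])
    show "integrable lborel (\<lambda>y. indicator (ball x r) y * (a / 2)\<^sup>2)"
      by (intro integrable_mult_left integrable_real_indicator emeasure_lborel_ball_finite) auto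
    show "indicator (ball x r) y * (a / 2)\<^sup>2 \<le> (cmod (g y))\<^sup>2" for y
    proof (cases "y \<in> ball x r")
      case True
      have "cmod (g x - g y) \<le> L * r"
        using L[of x y] True \<open>0 < L\<close> by (smt (verit) dist_norm mem_ball mult_left_mono)
      then have "a / 2 \<le> cmod (g y)"
        using norm_triangle_ineq2[of "g x" "g y"] \<open>0 < L\<close> by (simp add: a_def r_def)
      then show ?thesis
        using True \<open>0 < a\<close> by (auto intro!: power_mono)
    qed simp
  qed
  finally have *: "measure lborel (ball x r) * (a / 2)\<^sup>2 \<le> (\<integral>x. (cmod (g x))\<^sup>2 \<partial>lborel)" .
  have "measure lborel (ball x r) = r ^ CARD('n) * measure lborel (ball (0::real ^ 'n) 1)"
    using content_ball_conv_unit_ball[of r x] \<open>0 < r\<close> by simp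
  then have "L ^ CARD('n) * (measure lborel (ball x r) * (a / 2)\<^sup>2) = c * a ^ (CARD('n) + 2)"
    using \<open>0 < L\<close> by (simp add: c_def r_def power_divide power_mult_distrib power_add power2_eq_square field_simps)
  moreover have "L ^ CARD('n) * (measure lborel (ball x r) * (a / 2)\<^sup>2)
      \<le> L ^ CARD('n) * (\<integral>x. (cmod (g x))\<^sup>2 \<partial>lborel)"
    using * \<open>0 < L\<close> by (intro mult_left_mono) auto
  ultimately show ?thesis by (simp add: a_def)
qed (use \<open>0 < L\<close> in simp)

lemma measure_unit_ball_pos: "0 < measure lborel (ball (0::'a::euclidean_space) 1)"
  using content_ball_pos[of 1 "0::'a"] by simp

section \<open>Uniform boundedness\<close>

lemma test_fun_diff: "test_fun K u \<Longrightarrow> test_fun K v \<Longrightarrow> test_fun K (\<lambda>x. u x - v x)"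
  by (simp add: test_fun_def smooth_diff)

lemma test_fun_add_scale:
  fixes c :: complex
  shows "test_fun K u \<Longrightarrow> test_fun K v \<Longrightarrow> test_fun K (\<lambda>x. u x + c * v x)"
  using test_fun_diff[OF _ test_fun_scale[of K v "- c"]] by simp

lemma test_fun_zero: "test_fun K (\<lambda>_. 0)" "0 \<le> B \<Longrightarrow> (\<And>p. 0 < W p) \<Longrightarrow> deriv_bound W B (\<lambda>_. 0)"
proof -
  have *: "partials is (\<lambda>_. 0) = (\<lambda>_. 0)" for "is" :: "'n::finite list"
    by (intro ext) (rule partials_zero_outside[of "{}"], auto)
  show "test_fun K (\<lambda>_. 0)" by (simp add: test_fun_def smooth_def *)
  show "deriv_bound W B (\<lambda>_. 0)" if "0 \<le> B" "\<And>p. 0 < W p"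
    using that by (simp add: deriv_bound_def * less_imp_le)
qed

text \<open>The operator norm of integration against \<open>g\<close> on the test space with weight
  \<open>W\<close>. For compact \<open>K\<close> and a test function \<open>g\<close> the real
  supremum is over a bounded set, because members of the unit ball are bounded by
  \<open>W 0\<close>.\<close>

definition dual_norm ::
    "(nat \<Rightarrow> real) \<Rightarrow> (real ^ 'n::finite) set \<Rightarrow> (real ^ 'n \<Rightarrow> complex) \<Rightarrow> real" where
  "dual_norm W K g = (SUP u\<in>{u. test_fun K u \<and> deriv_bound W 1 u}. cmod (\<integral>x. g x * u x \<partial>lborel))"

lemma dual_norm_bdd:
  assumes K: "compact K" and g: "test_fun K g"
  shows "bdd_above ((\<lambda>u. cmod (\<integral>x. g x * u x \<partial>lborel)) ` {u. test_fun K u \<and> deriv_bound W 1 u})"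
proof (rule bdd_aboveI2)
  fix u assume "u \<in> {u. test_fun K u \<and> deriv_bound W 1 u}"
  then have u: "test_fun K u" "deriv_bound W 1 u" by auto
  have i: "integrable lborel (\<lambda>x. cmod (g x))"
    by (intro integrable_norm test_fun_integrable[OF K g])
  have "cmod (\<integral>x. g x * u x \<partial>lborel) \<le> (\<integral>x. cmod (g x) * W 0 \<partial>lborel)"
  proof (rule order_trans[OF integral_norm_bound integral_mono])
    show "integrable lborel (\<lambda>x. cmod (g x * u x))"
      by (intro integrable_norm test_fun_integrable_mult[OF K g] test_fun_smooth[OF u(1)])
    show "integrable lborel (\<lambda>x. cmod (g x) * W 0)"
      using i by simp
    show "cmod (g x * u x) \<le> cmod (g x) * W 0" for x
      using deriv_boundD[OF u(2), of "[]" x] by (auto simp: norm_mult intro!: mult_left_mono)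
  qed
  then show "cmod (\<integral>x. g x * u x \<partial>lborel) \<le> (\<integral>x. cmod (g x) * W 0 \<partial>lborel)" .
qed

lemma cmod_integral_le_dual_norm:
  assumes K: "compact K" and g: "test_fun K g" and u: "test_fun K u" "deriv_bound W B u" and "0 < B"
    and W: "\<And>p. 0 < W p"
  shows "cmod (\<integral>x. g x * u x \<partial>lborel) \<le> dual_norm W K g * B"
proof -
  have "deriv_bound W 1 (\<lambda>x. of_real (1 / B) * u x)"
    by (rule deriv_bound_scale[OF test_fun_smooth u(2)]) (use u \<open>0 < B\<close> W in \<open>auto simp: norm_divide\<close>)
  then have "cmod (\<integral>x. g x * (of_real (1 / B) * u x) \<partial>lborel) \<le> dual_norm W K g"
    unfolding dual_norm_def
    by (intro cSUP_upper dual_norm_bdd[OF K g] CollectI conjI test_fun_scale u)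
  moreover have "(\<integral>x. g x * (of_real (1 / B) * u x) \<partial>lborel) = of_real (1 / B) * (\<integral>x. g x * u x \<partial>lborel)"
    by (simp add: integral_mult_right_zero[symmetric] mult_ac del: integral_mult_right_zero)
  ultimately show ?thesis
    using \<open>0 < B\<close> by (simp add: norm_mult norm_divide field_simps)
qed

text \<open>The supremum need not be attained. The factor 2/3 leaves room against the tail of the
  geometric series with ratio 1/3 used next.\<close>

lemma almost_norming:
  assumes K: "compact K" and g: "test_fun K g" and W: "\<And>p. 0 < W p" and "0 < dual_norm W K g"
  obtains v where "test_fun K v" "deriv_bound W 1 v"
    "2 / 3 * dual_norm W K g \<le> cmod (\<integral>x. g x * v x \<partial>lborel)"
proof -
  have ne: "{u. test_fun K u \<and> deriv_bound W 1 u} \<noteq> {}"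
    using test_fun_zero(1) test_fun_zero(2)[of 1 W] W by (metis (no_types, lifting) empty_iff mem_Collect_eq zero_le_one)
  have "2 / 3 * dual_norm W K g < dual_norm W K g"
    using assms(4) by simp
  then obtain v where "v \<in> {u. test_fun K u \<and> deriv_bound W 1 u}"
    "2 / 3 * dual_norm W K g < cmod (\<integral>x. g x * v x \<partial>lborel)"
    using less_cSUP_iff[OF ne dual_norm_bdd[OF K g]] unfolding dual_norm_def by blast
  then show ?thesis using that by auto
qed

text \<open>Sokal's proof of the uniform boundedness principle: as one of \<open>cmod (a + b)\<close>,
  \<open>cmod (a - b)\<close> is at least \<open>cmod b\<close>, signs can be chosen along the series such that
  no cancellation occurs.\<close>

lemma condensation_of_singularities:
  fixes g :: "nat \<Rightarrow> real ^ 'n::finite \<Rightarrow> complex"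
  assumes K: "compact K" and g: "\<And>n. test_fun K (g n)" and W: "\<And>p. 0 < W p"
    and pos: "\<And>n. 0 < dual_norm W K (g n)"
  obtains u where "test_fun K u" "deriv_bound W (3 / 2) u"
    "\<And>n. dual_norm W K (g n) / (6 * 3 ^ n) \<le> cmod (\<integral>x. g n x * u x \<partial>lborel)"
proof -
  define T where "T n u = (\<integral>x. g n x * u x \<partial>lborel)" for n u
  have T_lin: "T n (\<lambda>x. u x + c * v x) = T n u + c * T n v" if "test_fun K u" "test_fun K v" for n u v c
  proof -
    have "integrable lborel (\<lambda>x. g n x * u x)" "integrable lborel (\<lambda>x. g n x * v x)"
      using that by (auto intro!: test_fun_integrable_mult[OF K g] test_fun_smooth)
    moreover have "g n x * (u x + c * v x) = g n x * u x + c * (g n x * v x)" for x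
      by (simp add: algebra_simps)
    ultimately show ?thesis by (simp add: T_def)
  qed
  have "\<exists>v. test_fun K v \<and> deriv_bound W 1 v \<and> 2 / 3 * dual_norm W K (g n) \<le> cmod (T n v)" for n
    using almost_norming[OF K g W pos] unfolding T_def by metis
  then obtain v where v: "\<And>n. test_fun K (v n)" "\<And>n. deriv_bound W 1 (v n)"
    "\<And>n. 2 / 3 * dual_norm W K (g n) \<le> cmod (T n (v n))" by metis
  define sgn :: "nat \<Rightarrow> (real ^ 'n \<Rightarrow> complex) \<Rightarrow> complex" where
    "sgn n u = (if cmod (T n (v n)) / 3 ^ n \<le> cmod (T n u + T n (v n) / 3 ^ n) then 1 else - 1)" for n u
  \<comment> \<open>Each sign depends on the partial sum reached so far, so the partial sums are
    defined by recursion first; \<open>c\<close> then reads off the coefficients and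
    \<open>X\<close> is recognised as their partial sums.\<close>
  define X where "X = rec_nat (\<lambda>_. 0) (\<lambda>n u x. u x + sgn n u / 3 ^ n * v n x)"
  define c where "c n = sgn n (X n) / 3 ^ n" for n
  have X_Suc: "X (Suc n) = (\<lambda>x. X n x + c n * v n x)" for n
    by (simp add: X_def c_def)
  have X: "X n = (\<lambda>x. \<Sum>j<n. c j * v j x)" for n
    by (induction n) (simp_all add: X_Suc, simp add: X_def)
  have X_test: "test_fun K (X n)" for n
    by (induction n) (simp_all add: X_Suc test_fun_add_scale v, simp add: X_def test_fun_zero)
  have cmod_c: "cmod (c n) = 1 / 3 ^ n" for n
    by (simp add: c_def sgn_def norm_divide norm_power)
  have T_X: "cmod (T n (v n)) / 3 ^ n \<le> cmod (T n (X (Suc n)))" for n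
  proof -
    define a b where "a = T n (X n)" and "b = T n (v n) / 3 ^ n"
    have b: "cmod b = cmod (T n (v n)) / 3 ^ n" by (simp add: b_def norm_divide norm_power)
    have "T n (X (Suc n)) = a + sgn n (X n) * b"
      unfolding X_Suc T_lin[OF X_test v(1)] by (simp add: a_def b_def c_def)
    moreover have "cmod (2 * b) \<le> cmod (a + b) + cmod (a - b)"
      using norm_triangle_ineq4[of "a + b" "a - b"] by simp
    ultimately show ?thesis
      unfolding b[symmetric] sgn_def by (auto simp: a_def b b_def[symmetric] norm_mult)
  qed
  have geo: "(\<lambda>j. 1 / 3 ^ (j + m)) sums (3 / 2 / 3 ^ m :: real)" for m
    using sums_divide[OF geometric_sums[of "1 / 3 :: real"], of "3 ^ m"]
    by (simp add: power_add power_divide)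
  define u where "u = (\<lambda>x. \<Sum>n. c n * v n x)"
  have u: "test_fun K u" "deriv_bound W (3 / 2) u"
    unfolding u_def using test_fun_series[where W = W, OF v(1,2) eq_refl[OF cmod_c] geo[of 0] W]
    by simp_all
  moreover have "dual_norm W K (g n) / (6 * 3 ^ n) \<le> cmod (T n u)" for n
  proof -
    \<comment> \<open>The remainder after index \<open>n\<close>: its norm is at most 3/2 / 3^(n+1),
      that is, half of 1 / 3^n.\<close>
    define R where "R = (\<lambda>x. \<Sum>j. c (j + Suc n) * v (j + Suc n) x)"
    have R: "test_fun K R" "deriv_bound W (3 / 2 / 3 ^ Suc n) R"
      unfolding R_def
      by (rule test_fun_series[where W = W, OF v(1,2) eq_refl[OF cmod_c] geo W])+
    have "u x = X (Suc n) x + 1 * R x" for x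
    proof -
      have "summable (\<lambda>n. c n * v n x)"
      proof (rule summable_comparison_test'[of "\<lambda>n. 1 / 3 ^ n * W 0" 0])
        show "summable (\<lambda>n. 1 / 3 ^ n * W 0 :: real)"
          using geo[of 0] by (intro summable_mult2) (simp add: sums_iff)
        show "norm (c n * v n x) \<le> 1 / 3 ^ n * W 0" for n
          using deriv_boundD[OF v(2)[of n], of "[]" x] unfolding norm_mult cmod_c by (intro mult_left_mono) auto
      qed
      from suminf_split_initial_segment[OF this, of "Suc n"] show ?thesis
        by (simp add: u_def R_def X)
    qed
    then have "u = (\<lambda>x. X (Suc n) x + 1 * R x)" by (rule ext)
    then have "T n u = T n (X (Suc n)) + T n R"
      using T_lin[OF X_test R(1), of n "Suc n" 1] by simp
    moreover have "cmod (T n (X (Suc n))) \<le> cmod (T n (X (Suc n)) + T n R) + cmod (T n R)"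
      using norm_triangle_ineq4[of "T n (X (Suc n)) + T n R" "T n R"] by simp
    ultimately have "cmod (T n (X (Suc n))) - cmod (T n R) \<le> cmod (T n u)"
      by simp
    moreover have "cmod (T n R) \<le> dual_norm W K (g n) * (3 / 2 / 3 ^ Suc n)"
      unfolding T_def by (rule cmod_integral_le_dual_norm[OF K g R _ W]) simp
    moreover have "2 / 3 * dual_norm W K (g n) / 3 ^ n \<le> cmod (T n (X (Suc n)))"
      using T_X[of n] v(3)[of n] by (meson divide_right_mono order_trans zero_le_numeral zero_le_power)
    \<comment> \<open>In units of the dual norm over 3^n, the partial sum contributes at least 2/3
      and the tail takes away at most 1/2; the remaining 1/6 is the constant in the
      conclusion.\<close>
    ultimately have "2 / 3 * dual_norm W K (g n) / 3 ^ n - dual_norm W K (g n) * (3 / 2 / 3 ^ Suc n)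
        \<le> cmod (T n u)"
      by (meson diff_mono order_trans)
    then show ?thesis by (simp add: field_simps)
  qed
  ultimately show ?thesis using that unfolding T_def by blast
qed

text \<open>In \<open>weak\<close> both the constant and the range of epsilon may depend on
  \<open>u\<close>. If no uniform bound held, a sequence of parameters tending to 0 along which the
  dual norms are too large would yield a single \<open>u\<close> violating
  \<open>weak\<close>.\<close>

lemma uniform_boundedness_at_right:
  fixes f :: "real \<Rightarrow> real ^ 'n::finite \<Rightarrow> complex"
  assumes K: "compact K" and f: "\<And>\<epsilon>. \<epsilon> \<in> {0<..<1} \<Longrightarrow> test_fun K (f \<epsilon>)" and W: "\<And>p. 0 < W p"
    and b: "\<And>\<epsilon>. 0 < b \<epsilon>"
    and weak: "\<And>u B. test_fun K u \<Longrightarrow> deriv_bound W B u \<Longrightarrow>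
       \<exists>C. \<forall>\<^sub>F \<epsilon> in at_right 0. cmod (\<integral>x. f \<epsilon> x * u x \<partial>lborel) \<le> C * b \<epsilon>"
  shows "\<exists>C>0. \<forall>\<^sub>F \<epsilon> in at_right 0. dual_norm W K (f \<epsilon>) \<le> C * b \<epsilon>"
proof (rule ccontr)
  assume contra: "\<not> ?thesis"
  \<comment> \<open>The growth 4^n outruns the loss 3^n of the condensation lemma, leaving (4/3)^n.
    The bound 1 / (n + 2) forces convergence to 0 and keeps the parameters below 1, where
    \<open>f\<close> consists of test functions.\<close>
  have "\<exists>\<epsilon>\<in>{0<..<1 / real (n + 2)}. 4 ^ n * b \<epsilon> < dual_norm W K (f \<epsilon>)" for n
  proof (rule ccontr)
    assume "\<not> ?thesis"
    then have "\<forall>\<^sub>F \<epsilon> in at_right 0. dual_norm W K (f \<epsilon>) \<le> 4 ^ n * b \<epsilon>"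
      unfolding eventually_at_right_field by (intro exI[of _ "1 / real (n + 2)"]) (auto simp: not_less)
    then show False using contra zero_less_power[of "4::real" n] by auto
  qed
  then obtain e where e: "\<And>n. e n \<in> {0<..<1 / real (n + 2)}"
    and large: "\<And>n. 4 ^ n * b (e n) < dual_norm W K (f (e n))" by metis
  have "e n \<in> {0<..<1}" for n
    using e[of n] by (auto intro: less_le_trans)
  then have fe: "test_fun K (f (e n))" for n by (rule f)
  have dpos: "0 < dual_norm W K (f (e n))" for n
    using large[of n] b[of "e n"] by (smt (verit) mult_pos_pos zero_less_power)
  obtain u where u: "test_fun K u" "deriv_bound W (3 / 2) u"
    and lower: "\<And>n. dual_norm W K (f (e n)) / (6 * 3 ^ n) \<le> cmod (\<integral>x. f (e n) x * u x \<partial>lborel)"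
    by (rule condensation_of_singularities[where g = "\<lambda>n. f (e n)", OF K fe W dpos]) (rule that)
  obtain C where "\<forall>\<^sub>F \<epsilon> in at_right 0. cmod (\<integral>x. f \<epsilon> x * u x \<partial>lborel) \<le> C * b \<epsilon>"
    using weak[OF u] by blast
  moreover have "filterlim e (at_right 0) sequentially"
  proof (rule filterlim_at_withinI)
    have "(\<lambda>n. inverse (real (Suc (Suc n)))) \<longlonglongrightarrow> 0"
      by (subst filterlim_sequentially_Suc) (rule LIMSEQ_inverse_real_of_nat)
    then show "e \<longlonglongrightarrow> 0"
      by (rule tendsto_sandwich[OF _ _ tendsto_const, rotated 2])
        (use e in \<open>auto intro!: always_eventually less_imp_le simp: inverse_eq_divide add.commute\<close>)
    show "\<forall>\<^sub>F n in sequentially. e n \<in> {0<..} - {0}"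
      using e by (intro always_eventually) auto
  qed
  ultimately have "\<forall>\<^sub>F n in sequentially. cmod (\<integral>x. f (e n) x * u x \<partial>lborel) \<le> C * b (e n)"
    by (rule eventually_compose_filterlim)
  moreover have "\<forall>\<^sub>F n in sequentially. 6 * C < (4 / 3) ^ n"
  proof -
    obtain N where N: "6 * C < (4 / 3) ^ N"
      using real_arch_pow[of "4 / 3" "6 * C"] by auto
    have "6 * C < (4 / 3) ^ n" if "N \<le> n" for n
      by (rule less_le_trans[OF N power_increasing[OF that]]) simp
    then show ?thesis by (auto simp: eventually_sequentially)
  qed
  ultimately have "\<forall>\<^sub>F n in sequentially. False"
  proof eventually_elim
    case (elim n)
    have "4 ^ n * b (e n) / (6 * 3 ^ n) < C * b (e n)"
      using large[of n] lower[of n] elim(1)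
      by (smt (verit) divide_strict_right_mono zero_less_power mult_pos_pos)
    then have "(4 / 3) ^ n < 6 * C"
      using b[of "e n"] by (simp add: power_divide field_simps)
    with elim(2) show ?case by simp
  qed
  then show False by simp
qed

section \<open>Classes of weights\<close>

lemma assoc_fun_nonneg:
  assumes "\<And>p. 0 < W p" "(\<lambda>p. W p / W (Suc p)) \<longlonglongrightarrow> 0" "0 \<le> \<rho>"
  shows "0 \<le> assoc_fun W \<rho>"
  unfolding assoc_fun_def
  by (rule order_trans[OF _ cSUP_upper[OF UNIV_I assoc_fun_bdd_above[OF assms], of 0]]) simp

lemma assoc_fun_antimono:
  assumes U: "\<And>p. 0 < U p" "(\<lambda>p. U p / U (Suc p)) \<longlonglongrightarrow> 0"
    and W: "\<And>p. U p \<le> W p" and "0 < \<rho>"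
  shows "assoc_fun W \<rho> \<le> assoc_fun U \<rho>"
  unfolding assoc_fun_def
proof (rule cSUP_mono)
  show "bdd_above (range (\<lambda>p. max (ln (\<rho> ^ p / U p)) 0))"
    using assms by (intro assoc_fun_bdd_above) auto
  fix p
  have "\<rho> ^ p / W p \<le> \<rho> ^ p / U p"
    using U(1)[of p] W[of p] \<open>0 < \<rho>\<close> by (intro divide_left_mono mult_pos_pos) auto
  moreover have "0 < \<rho> ^ p / W p"
    using U(1)[of p] W[of p] \<open>0 < \<rho>\<close> by auto
  ultimately have "ln (\<rho> ^ p / W p) \<le> ln (\<rho> ^ p / U p)"
    by (meson ln_mono)
  then show "\<exists>q\<in>UNIV. max (ln (\<rho> ^ p / W p)) 0 \<le> max (ln (\<rho> ^ q / U q)) 0"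
    by (intro bexI[of _ p]) auto
qed auto

text \<open>Squaring the term of index p for \<open>W\<close> gives at most \<open>C\<close> times
  the term of index 2p for \<open>U\<close>. With the weights of the Beurling case this is Komatsu's
  consequence of (M.2): 2 M(rho) <= M(H rho) + ln c_0.\<close>

lemma assoc_fun_double:
  assumes U: "\<And>p. 0 < U p" "(\<lambda>p. U p / U (Suc p)) \<longlonglongrightarrow> 0"
    and W: "\<And>p. 0 < W p" "\<And>p. U (p + p) \<le> C * (W p * W p)" and "0 < \<rho>"
  shows "2 * assoc_fun W \<rho> \<le> assoc_fun U \<rho> + max (ln C) 0"
proof -
  have "0 < C"
    using U(1)[of 0] W(1)[of 0] W(2)[of 0] by (smt (verit) mult_nonpos_nonneg add_0 mult_pos_pos)
  have upper: "max (ln (\<rho> ^ q / U q)) 0 \<le> assoc_fun U \<rho>" for q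
    unfolding assoc_fun_def using assms by (intro cSUP_upper assoc_fun_bdd_above) auto
  have "max (ln (\<rho> ^ p / W p)) 0 \<le> (assoc_fun U \<rho> + max (ln C) 0) / 2" for p
  proof (cases "ln (\<rho> ^ p / W p) \<le> 0")
    case True
    moreover have "0 \<le> assoc_fun U \<rho>"
      using assms by (intro assoc_fun_nonneg) auto
    ultimately show ?thesis by simp
  next
    case False
    have "2 * ln (\<rho> ^ p / W p) = ln ((\<rho> ^ p / W p)\<^sup>2)"
      using \<open>0 < \<rho>\<close> W(1)[of p] by (simp add: ln_realpow)
    also have "\<dots> \<le> ln (C * (\<rho> ^ (p + p) / U (p + p)))"
    proof (rule ln_mono)
      have "\<rho> ^ (p + p) * U (p + p) \<le> \<rho> ^ (p + p) * (C * (W p * W p))"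
        using \<open>0 < \<rho>\<close> W(2)[of p] by (intro mult_left_mono) auto
      then show "(\<rho> ^ p / W p)\<^sup>2 \<le> C * (\<rho> ^ (p + p) / U (p + p))"
        using W(1)[of p] U(1)[of "p + p"] \<open>0 < \<rho>\<close>
        by (simp add: power_divide power2_eq_square power_add field_simps)
    qed (use \<open>0 < \<rho>\<close> W(1)[of p] in simp)
    also have "\<dots> = ln C + ln (\<rho> ^ (p + p) / U (p + p))"
      using \<open>0 < C\<close> \<open>0 < \<rho>\<close> U(1)[of "p + p"] by (intro ln_mult_pos) auto
    also have "\<dots> \<le> max (ln C) 0 + assoc_fun U \<rho>"
      using upper[of "p + p"] by (intro add_mono) auto
    finally show ?thesis using False by simp
  qed
  then have "assoc_fun W \<rho> \<le> (assoc_fun U \<rho> + max (ln C) 0) / 2"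
    unfolding assoc_fun_def[of W] by (intro cSUP_least) auto
  then show ?thesis by simp
qed

text \<open>The set \<open>\<W>\<close> has two roles: its members define the norms, and their
  associated functions at 1/epsilon define the scales of growth and decay. Smaller weights give
  stronger norms and larger scales. \<open>weight_ratio\<close> makes the suprema in
  \<open>assoc_fun\<close> finite.\<close>

locale weight_family =
  fixes \<W> :: "(nat \<Rightarrow> real) set"
  assumes weight_pos: "W \<in> \<W> \<Longrightarrow> 0 < W p"
    and weight_0: "W \<in> \<W> \<Longrightarrow> W 0 = 1"
    and weight_ratio: "W \<in> \<W> \<Longrightarrow> (\<lambda>p. W p / W (Suc p)) \<longlonglongrightarrow> 0"
    and weight_split: "W \<in> \<W> \<Longrightarrow> \<exists>U\<in>\<W>. \<exists>C. \<forall>p q. U (p + q) \<le> C * (W p * W q)"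
    and weight_directed: "U \<in> \<W> \<Longrightarrow> W \<in> \<W> \<Longrightarrow> \<exists>Z\<in>\<W>. \<forall>p. Z p \<le> U p \<and> Z p \<le> W p"
begin

lemma assoc_fun_multiple:
  assumes "W \<in> \<W>"
  shows "\<exists>U\<in>\<W>. \<exists>c. \<forall>\<rho>>0. 2 ^ n * assoc_fun W \<rho> \<le> assoc_fun U \<rho> + c"
proof (induction n)
  case 0
  then show ?case using assms by (auto intro!: bexI[of _ W] exI[of _ 0])
next
  case (Suc n)
  then obtain U c where U: "U \<in> \<W>" and c: "\<And>\<rho>. 0 < \<rho> \<Longrightarrow> 2 ^ n * assoc_fun W \<rho> \<le> assoc_fun U \<rho> + c"
    by blast
  from weight_split[OF U] obtain Z C where Z: "Z \<in> \<W>" and C: "\<And>p q. Z (p + q) \<le> C * (U p * U q)" by blast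
  have "2 ^ Suc n * assoc_fun W \<rho> \<le> assoc_fun Z \<rho> + (max (ln C) 0 + 2 * c)" if "0 < \<rho>" for \<rho>
    using assoc_fun_double[OF weight_pos[OF Z] weight_ratio[OF Z] weight_pos[OF U] C that] c[OF that]
    by simp
  then show ?case using Z by blast
qed

text \<open>One decay scale \<open>Z\<close> pays for \<open>m\<close> factors of growth
  \<open>U\<close> and still leaves the \<open>n\<close>-th power of the decay \<open>X\<close>
  wanted here under the name \<open>W\<close>. With \<open>Y\<close> below both weights, m + n
  copies of its associated function are at most 2^(m+n) copies, and repeated doubling turns these
  into a single one.\<close>

lemma exp_assoc_fun_absorb:
  assumes U: "U \<in> \<W>" and W: "W \<in> \<W>"
  shows "\<exists>Z\<in>\<W>. \<exists>C>0. \<forall>\<rho>>0. exp (assoc_fun U \<rho>) ^ m * exp (- assoc_fun Z \<rho>) \<le> C * exp (- assoc_fun W \<rho>) ^ n"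
proof -
  obtain Y where Y: "Y \<in> \<W>" and YU: "\<And>p. Y p \<le> U p" and YW: "\<And>p. Y p \<le> W p"
    using weight_directed[OF U W] by blast
  obtain Z c where Z: "Z \<in> \<W>"
    and c: "\<And>\<rho>. 0 < \<rho> \<Longrightarrow> 2 ^ (m + n) * assoc_fun Y \<rho> \<le> assoc_fun Z \<rho> + c"
    using assoc_fun_multiple[OF Y] by blast
  have "exp (assoc_fun U \<rho>) ^ m * exp (- assoc_fun Z \<rho>) \<le> exp c * exp (- assoc_fun W \<rho>) ^ n"
    if "0 < \<rho>" for \<rho>
  proof -
    have "assoc_fun U \<rho> \<le> assoc_fun Y \<rho>" "assoc_fun W \<rho> \<le> assoc_fun Y \<rho>" "0 \<le> assoc_fun Y \<rho>"
      using that Y YU YW by (auto intro!: assoc_fun_antimono assoc_fun_nonneg weight_pos weight_ratio)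
    then have "m * assoc_fun U \<rho> + n * assoc_fun W \<rho> \<le> real (m + n) * assoc_fun Y \<rho>"
      unfolding of_nat_add distrib_right by (intro add_mono mult_left_mono) auto
    also have "\<dots> \<le> 2 ^ (m + n) * assoc_fun Y \<rho>"
      by (rule mult_right_mono[OF less_imp_le[OF of_nat_less_two_power] \<open>0 \<le> assoc_fun Y \<rho>\<close>])
    also have "\<dots> \<le> assoc_fun Z \<rho> + c" by (rule c[OF that])
    finally have "m * assoc_fun U \<rho> - assoc_fun Z \<rho> \<le> c - n * assoc_fun W \<rho>" by simp
    then have "exp (m * assoc_fun U \<rho> + - assoc_fun Z \<rho>) \<le> exp (c + n * - assoc_fun W \<rho>)" by simp
    then show ?thesis unfolding exp_add exp_of_nat_mult .
  qed
  then show ?thesis using Z by (intro bexI[of _ Z] exI[of _ "exp c"]) auto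
qed

lemma negligible_if_weakly_negligible:
  fixes f :: "real \<Rightarrow> real ^ 'n::finite \<Rightarrow> complex"
  assumes K: "compact K" and f: "\<And>\<epsilon>. \<epsilon> \<in> {0<..<1} \<Longrightarrow> test_fun K (f \<epsilon>)"
    and moderate: "\<And>W. W \<in> \<W> \<Longrightarrow> \<exists>U\<in>\<W>. \<exists>C>0.
      \<forall>\<^sub>F \<epsilon> in at_right 0. deriv_bound W (C * exp (assoc_fun U (1 / \<epsilon>))) (f \<epsilon>)"
    and V: "V \<in> \<W>"
    and weak: "\<And>u B Z. test_fun K u \<Longrightarrow> deriv_bound V B u \<Longrightarrow> Z \<in> \<W> \<Longrightarrow>
      \<exists>C. \<forall>\<^sub>F \<epsilon> in at_right 0. cmod (\<integral>x. f \<epsilon> x * u x \<partial>lborel) \<le> C * exp (- assoc_fun Z (1 / \<epsilon>))"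
    and W: "W \<in> \<W>" and X: "X \<in> \<W>"
  shows "\<exists>C>0. \<forall>\<^sub>F \<epsilon> in at_right 0. deriv_bound W (C * exp (- assoc_fun X (1 / \<epsilon>))) (f \<epsilon>)"
proof -
  define d where "d = CARD('n)"
  \<comment> \<open>The choices give W2(j + 2p) <= C2 * Y j * Y (2p) <= C2 * V j * C1 * (W p)^2: the
    j derivatives of a test function are measured by \<open>V\<close>, the 2p derivatives of
    \<open>f\<close> by \<open>W\<close>. Only then are the growth \<open>U\<close> for
    \<open>W2\<close> and the decay \<open>Z\<close> absorbing it fixed.\<close>
  obtain W1 C1 where W1: "W1 \<in> \<W>" and C1: "\<And>p q. W1 (p + q) \<le> C1 * (W p * W q)"
    using weight_split[OF W] by blast
  obtain Y where Y: "Y \<in> \<W>" "\<And>p. Y p \<le> V p" "\<And>p. Y p \<le> W1 p"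
    using weight_directed[OF V W1] by blast
  obtain W2 C2 where W2: "W2 \<in> \<W>" and C2: "\<And>p q. W2 (p + q) \<le> C2 * (Y p * Y q)"
    using weight_split[OF Y(1)] by blast
  have "0 < C1" "0 < C2"
    using C1[of 0 0] C2[of 0 0] weight_0[OF W] weight_0[OF W1] weight_0[OF W2] weight_0[OF Y(1)] by auto
  note pos = weight_pos[OF W] weight_pos[OF W1] weight_pos[OF W2] weight_pos[OF V] weight_pos[OF Y(1)]
  obtain U C3 where U: "U \<in> \<W>" and "0 < C3"
    and C3: "\<forall>\<^sub>F \<epsilon> in at_right 0. deriv_bound W2 (C3 * exp (assoc_fun U (1 / \<epsilon>))) (f \<epsilon>)"
    using moderate[OF W2] by blast
  obtain Z C4 where Z: "Z \<in> \<W>" and "0 < C4"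
    and C4: "\<And>\<rho>. 0 < \<rho> \<Longrightarrow> exp (assoc_fun U \<rho>) ^ (d + 1) * exp (- assoc_fun Z \<rho>)
        \<le> C4 * exp (- assoc_fun X \<rho>) ^ (d + 2)"
    using exp_assoc_fun_absorb[OF U X, of "d + 1" "d + 2"] by blast
  \<comment> \<open>From here on the pairing estimate also applies to test functions that depend on
    epsilon.\<close>
  have "\<exists>C>0. \<forall>\<^sub>F \<epsilon> in at_right 0. dual_norm V K (f \<epsilon>) \<le> C * exp (- assoc_fun Z (1 / \<epsilon>))"
    by (rule uniform_boundedness_at_right[OF K f weight_pos[OF V] exp_gt_zero]) (auto intro: weak Z)
  then obtain C5 where "0 < C5"
    and C5: "\<forall>\<^sub>F \<epsilon> in at_right 0. dual_norm V K (f \<epsilon>) \<le> C5 * exp (- assoc_fun Z (1 / \<epsilon>))"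
    by blast
  define c where "c = measure lborel (ball (0::real ^ 'n) 1) / 2 ^ (d + 2)"
  have "0 < c" using measure_unit_ball_pos[where 'a = "real ^ 'n"] by (simp add: c_def)
  \<comment> \<open>The first factor comes from L^d, the second from the pairing, \<open>C3\<close>
    from the d + 1 moderate factors, \<open>C4\<close> from absorbing them, and 1/c from the passage
    to suprema.\<close>
  define C6 where "C6 = (real d * (C2 * C1 * W 1)) ^ d * (C5 * C2 * C1) * C3 ^ (d + 1) * C4 / c"
  have "0 < C6"
    using \<open>0 < C1\<close> \<open>0 < C2\<close> \<open>0 < C3\<close> \<open>0 < C4\<close> \<open>0 < C5\<close> \<open>0 < c\<close> weight_pos[OF W, of 1]
    by (simp add: C6_def d_def)
  have "\<forall>\<^sub>F \<epsilon> in at_right 0. \<epsilon> \<in> {0<..<1::real}"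
    by (rule eventually_at_right_real) simp
  with C3 C5 have "\<forall>\<^sub>F \<epsilon> in at_right 0. deriv_bound W ((1 + C6) * exp (- assoc_fun X (1 / \<epsilon>))) (f \<epsilon>)"
  proof eventually_elim
    case (elim \<epsilon>)
    define F where "F = C3 * exp (assoc_fun U (1 / \<epsilon>))"
    define eZ where "eZ = exp (- assoc_fun Z (1 / \<epsilon>))"
    define eX where "eX = exp (- assoc_fun X (1 / \<epsilon>))"
    have "0 < F" "0 < eZ" "0 < eX" using \<open>0 < C3\<close> by (simp_all add: F_def eZ_def eX_def)
    have test: "test_fun K (f \<epsilon>)" by (rule f[OF elim(3)])
    note smooth = test_fun_smooth[OF test]
    have bound: "cmod (partials js (f \<epsilon>) x) \<le> F * W2 (length js)" for js x
      using elim(1) by (simp add: deriv_bound_def F_def)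
    show ?case
      unfolding deriv_bound_def eX_def[symmetric]
    proof (intro allI)
      fix "is" :: "'n list" and x
      define p where "p = length is"
      define a where "a = cmod (partials is (f \<epsilon>) x)"
      have test_is: "test_fun K (partials is (f \<epsilon>))"
        by (rule test_fun_partials[OF compact_imp_closed[OF K] test])
      define L where "L = real d * (F * (C2 * C1 * (W p * W 1)))"
      have "0 < L"
        using \<open>0 < F\<close> \<open>0 < C1\<close> \<open>0 < C2\<close> pos by (simp add: L_def d_def)
      have W2_Suc: "W2 (Suc p) \<le> C2 * C1 * (W p * W 1)"
      proof -
        \<comment> \<open>Splitting off 0 and using \<open>Y 0 = 1\<close> compares
          \<open>W2\<close> with \<open>Y\<close> itself, which lies below \<open>W1\<close>; this
          reaches p + 1 with the same weights as 2p.\<close>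
        have "W2 (Suc p) \<le> C2 * Y (Suc p)"
          using C2[of "Suc p" 0] weight_0[OF Y(1)] by simp
        also have "\<dots> \<le> C2 * (C1 * (W p * W 1))"
          using Y(3)[of "Suc p"] C1[of p 1] \<open>0 < C2\<close> by (intro mult_left_mono) auto
        finally show ?thesis by simp
      qed
      have "cmod (partial i (partials is (f \<epsilon>)) y) \<le> F * (C2 * C1 * (W p * W 1))" for i y
      proof -
        have "cmod (partial i (partials is (f \<epsilon>)) y) \<le> F * W2 (Suc p)"
          using bound[of "i # is" y] by (simp add: p_def)
        also have "\<dots> \<le> F * (C2 * C1 * (W p * W 1))"
          using \<open>0 < F\<close> by (intro mult_left_mono W2_Suc) simp
        finally show ?thesis .
      qed
      from smooth_Lipschitz[OF test_fun_smooth[OF test_is] this]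
      have "c * a ^ (d + 2) \<le> L ^ d * (\<integral>x. (cmod (partials is (f \<epsilon>) x))\<^sup>2 \<partial>lborel)"
        unfolding a_def c_def d_def
        by (intro power_sup_le_L2[OF K test_is]) (use \<open>0 < L\<close> in \<open>simp_all add: L_def d_def\<close>)
      also have "(\<integral>x. (cmod (partials is (f \<epsilon>) x))\<^sup>2 \<partial>lborel)
          \<le> dual_norm V K (f \<epsilon>) * (F * (C2 * C1 * (W p * W p)))"
      proof -
        define v where "v = (\<lambda>x. cnj (partials (rev is @ is) (f \<epsilon>) x))"
        have v: "test_fun K v"
          unfolding v_def by (intro test_fun_cnj test_fun_partials compact_imp_closed K test)
        have "deriv_bound V (F * (C2 * C1 * (W p * W p))) v"
          unfolding deriv_bound_def
        proof (intro allI)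
          fix js y
          have "cmod (partials js v y) \<le> F * W2 (length js + (p + p))"
            using bound[of "js @ rev is @ is" y]
            by (simp add: v_def partials_cnj smooth_partials smooth partials_append p_def)
          also have "\<dots> \<le> F * (C2 * (Y (length js) * Y (p + p)))"
            using \<open>0 < F\<close> by (intro mult_left_mono C2) auto
          also have "\<dots> \<le> F * (C2 * (V (length js) * (C1 * (W p * W p))))"
            using \<open>0 < F\<close> \<open>0 < C2\<close> pos Y(2)[of "length js"] Y(3)[of "p + p"] C1[of p p]
            by (intro mult_left_mono mult_mono) (auto intro: less_imp_le)
          finally show "cmod (partials js v y) \<le> F * (C2 * C1 * (W p * W p)) * V (length js)"
            by (simp add: mult_ac)
        qed
        from cmod_integral_le_dual_norm[OF K test v this _ pos(4)] show ?thesis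
          unfolding L2_norm_partials[OF K test] v_def[symmetric]
          using \<open>0 < F\<close> \<open>0 < C1\<close> \<open>0 < C2\<close> pos(1)[of p] unfolding v_def by simp
      qed
      also have "\<dots> \<le> C5 * eZ * (F * (C2 * C1 * (W p * W p)))"
        using elim(2) \<open>0 < F\<close> \<open>0 < C1\<close> \<open>0 < C2\<close> pos(1)[of p]
        by (intro mult_right_mono) (auto simp: eZ_def)
      finally have "c * a ^ (d + 2) \<le> L ^ d * (C5 * eZ * (F * (C2 * C1 * (W p * W p))))"
        using \<open>0 < L\<close> by (simp add: mult_left_mono)
      \<comment> \<open>Here L^d supplies d factors \<open>W p\<close> and d exponentials, and the
        pairing supplies two and one more.\<close>
      also have "\<dots> = (real d * (C2 * C1 * W 1)) ^ d * (C5 * C2 * C1) * C3 ^ (d + 1)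
          * (exp (assoc_fun U (1 / \<epsilon>)) ^ (d + 1) * eZ) * W p ^ (d + 2)"
        by (simp add: L_def F_def power_mult_distrib power_add power2_eq_square mult_ac)
      also have "\<dots> \<le> (real d * (C2 * C1 * W 1)) ^ d * (C5 * C2 * C1) * C3 ^ (d + 1)
          * (C4 * eX ^ (d + 2)) * W p ^ (d + 2)"
      proof (intro mult_right_mono mult_left_mono)
        show "exp (assoc_fun U (1 / \<epsilon>)) ^ (d + 1) * eZ \<le> C4 * eX ^ (d + 2)"
          unfolding eZ_def eX_def by (rule C4) (use elim(3) in simp)
        show "0 \<le> (real d * (C2 * C1 * W 1)) ^ d * (C5 * C2 * C1) * C3 ^ (d + 1)"
          using \<open>0 < C1\<close> \<open>0 < C2\<close> \<open>0 < C3\<close> \<open>0 < C5\<close> pos(1)[of 1]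
          by (intro mult_nonneg_nonneg zero_le_power) auto
        show "0 \<le> W p ^ (d + 2)"
          using pos(1)[of p] by simp
      qed
      also have "\<dots> = c * (C6 * (eX * W p) ^ (d + 2))"
        using \<open>0 < c\<close> by (simp add: C6_def power_mult_distrib)
      finally have "a ^ (d + 2) \<le> C6 * (eX * W p) ^ (d + 2)"
        using \<open>0 < c\<close> by simp
      \<comment> \<open>Since 1 + C6 is at least 1, it is bounded by its own power; this makes the
        right side a perfect power and avoids taking a root of \<open>C6\<close>.\<close>
      also have "\<dots> \<le> (1 + C6) ^ (d + 2) * (eX * W p) ^ (d + 2)"
      proof (rule mult_right_mono)
        have "1 + C6 \<le> (1 + C6) ^ (d + 2)"
          using \<open>0 < C6\<close> by (intro self_le_power) auto
        then show "C6 \<le> (1 + C6) ^ (d + 2)" by linarith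
        show "0 \<le> (eX * W p) ^ (d + 2)"
          using \<open>0 < eX\<close> pos(1)[of p] by simp
      qed
      also have "\<dots> = ((1 + C6) * eX * W p) ^ (d + 2)"
        by (simp add: power_mult_distrib mult.assoc)
      finally have "a \<le> (1 + C6) * eX * W p"
        using \<open>0 < C6\<close> \<open>0 < eX\<close> pos(1)[of p]
        by (intro power_le_imp_le_base[of a "d + 1"]) simp_all
      then show "cmod (partials is (f \<epsilon>) x) \<le> (1 + C6) * eX * W (length is)"
        by (simp add: a_def p_def)
    qed
  qed
  then show ?thesis using \<open>0 < C6\<close> by (intro exI[of _ "1 + C6"]) auto
qed

end

section \<open>Generalized functions over a class of weights\<close>

text \<open>Points outside \<open>\<Omega>\<close> lie in the open complement of \<open>K\<close>,
  where the extension by zero vanishes locally, so smoothness on \<open>\<Omega>\<close> extends to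
  the whole space.\<close>

lemma C_infinity_imp_test_fun:
  assumes "open \<Omega>" "closed K" "K \<subseteq> \<Omega>" "u \<in> C_infinity \<Omega>" "supp \<Omega> u \<subseteq> K"
  shows "test_fun K u"
proof -
  have zero: "u x = 0" if "x \<notin> K" for x
    using assms(4,5) that closure_subset[of "{x \<in> \<Omega>. u x \<noteq> 0}"]
    by (auto simp: C_infinity_def supp_def)
  have "partials is u differentiable (at x)" for "is" x
  proof (cases "x \<in> \<Omega>")
    case False
    have "(partials is u has_derivative (\<lambda>_. 0)) (at x)"
      by (rule has_derivative_transform_within_open[of "\<lambda>_. 0" _ _ _ "- K"])
        (use False assms(2,3) zero in \<open>auto simp: open_Compl partials_zero_outside\<close>)
    then show ?thesis by (rule differentiableI)
  qed (use assms(4) in \<open>simp add: C_infinity_def\<close>)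
  then show ?thesis using zero by (simp add: test_fun_def smooth_def)
qed

lemma test_fun_imp_C_infinity:
  assumes "closed K" "K \<subseteq> \<Omega>" "test_fun K u"
  shows "u \<in> C_infinity \<Omega>" "supp \<Omega> u \<subseteq> K"
proof -
  show "u \<in> C_infinity \<Omega>"
    using assms by (auto simp: C_infinity_def test_fun_def smooth_def)
  have "closure {x \<in> \<Omega>. u x \<noteq> 0} \<subseteq> K"
    using assms by (intro closure_minimal) (auto simp: test_fun_def)
  then show "supp \<Omega> u \<subseteq> K" by (auto simp: supp_def)
qed

text \<open>The set \<open>S\<close> is arbitrary because \<open>deriv_bound\<close> is global;
  estimates found on \<open>K\<close> thereby reach every compact set.\<close>

lemma weighted_norm_le:
  assumes "\<And>p. 0 < W p" "smooth u" "deriv_bound W B u"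
  shows "weighted_norm W S u \<le> ennreal B"
  unfolding weighted_norm_def
proof (intro SUP_least)
  fix x and \<alpha> :: "'a \<Rightarrow> nat"
  obtain "is" where "is": "multi_deriv \<alpha> = partials is" "mi_order \<alpha> = length is"
    by (rule multi_deriv_obtain)
  show "ennreal (cmod (multi_deriv \<alpha> u x) / W (mi_order \<alpha>)) \<le> ennreal B"
    unfolding "is" using deriv_boundD[OF assms(3), of "is" x] assms(1)[of "length is"]
    by (intro ennreal_leI) (simp add: field_simps)
qed

lemma deriv_bound_if_weighted_norm_le:
  assumes W: "\<And>p. 0 < W p" and K: "closed K" and u: "test_fun K u"
    and le: "weighted_norm W K u \<le> ennreal B" and "0 \<le> B"
  shows "deriv_bound W B u"
  unfolding deriv_bound_def
proof (intro allI)
  fix "is" x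
  show "cmod (partials is u x) \<le> B * W (length is)"
  proof (cases "x \<in> K")
    case True
    have "ennreal (cmod (multi_deriv (count_list is) u x) / W (mi_order (count_list is))) \<le> weighted_norm W K u"
      unfolding weighted_norm_def
      by (rule SUP_upper2[OF True]) (rule SUP_upper, simp)
    also note le
    finally have "cmod (partials is u x) / W (length is) \<le> B"
      using \<open>0 \<le> B\<close> by (simp add: partials_eq_multi_deriv[OF test_fun_smooth[OF u]])
    then show ?thesis using W[of "length is"] by (simp add: field_simps)
  next
    case False
    then have "partials is u x = 0"
      using u K by (intro partials_zero_outside[of K]) (auto simp: test_fun_def)
    then show ?thesis using \<open>0 \<le> B\<close> W[of "length is"] by simp
  qed
qed

lemma C_infinity_diff:
  assumes "open \<Omega>" "u \<in> C_infinity \<Omega>" "v \<in> C_infinity \<Omega>"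
  shows "(\<lambda>x. u x - v x) \<in> C_infinity \<Omega>"
  using assms partials_diff(2)[of \<Omega> u v] by (simp add: C_infinity_def)

lemma weighted_norm_diff:
  assumes "open \<Omega>" "u \<in> C_infinity \<Omega>" "v \<in> C_infinity \<Omega>" "S \<subseteq> \<Omega>" and W: "\<And>p. 0 < W p"
  shows "weighted_norm W S (\<lambda>x. u x - v x) \<le> weighted_norm W S u + weighted_norm W S v"
  unfolding weighted_norm_def[of _ _ "\<lambda>x. u x - v x"]
proof (intro SUP_least)
  fix x and \<alpha> :: "'a \<Rightarrow> nat"
  assume "x \<in> S"
  obtain "is" where "is": "multi_deriv \<alpha> = partials is" "mi_order \<alpha> = length is"
    by (rule multi_deriv_obtain)
  let ?q = "\<lambda>w. cmod (multi_deriv \<alpha> w x) / W (mi_order \<alpha>)"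
  have "multi_deriv \<alpha> (\<lambda>x. u x - v x) x = multi_deriv \<alpha> u x - multi_deriv \<alpha> v x"
    unfolding "is" using assms \<open>x \<in> S\<close> by (intro partials_diff[of \<Omega>]) (auto simp: C_infinity_def)
  then have "?q (\<lambda>x. u x - v x) \<le> ?q u + ?q v"
    using W[of "mi_order \<alpha>"] by (auto simp: add_divide_distrib[symmetric] norm_triangle_ineq4 divide_right_mono less_imp_le)
  then have "ennreal (?q (\<lambda>x. u x - v x)) \<le> ennreal (?q u + ?q v)"
    by (rule ennreal_leI)
  also have "\<dots> = ennreal (?q u) + ennreal (?q v)"
    using W[of "mi_order \<alpha>"] by (intro ennreal_plus) auto
  also have "\<dots> \<le> weighted_norm W S u + weighted_norm W S v"
    unfolding weighted_norm_def
    by (intro add_mono SUP_upper2[OF \<open>x \<in> S\<close>] SUP_upper) simp_all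
  finally show "ennreal (?q (\<lambda>x. u x - v x)) \<le> weighted_norm W S u + weighted_norm W S v" .
qed

section \<open>Order estimates for nets as epsilon tends to 0, and equality of classes\<close>

lemma net_bigo_iff_eventually:
  "net_bigo a b \<longleftrightarrow> (\<exists>C>0. \<forall>\<^sub>F \<epsilon> in at_right 0. a \<epsilon> \<le> ennreal (C * b \<epsilon>))"
proof
  assume "net_bigo a b"
  then obtain C e where "0 < C" "e \<in> {0<..<1}" "\<forall>\<epsilon>\<in>{0<..<e}. a \<epsilon> \<le> ennreal (C * b \<epsilon>)"
    by (auto simp: net_bigo_def)
  then show "\<exists>C>0. \<forall>\<^sub>F \<epsilon> in at_right 0. a \<epsilon> \<le> ennreal (C * b \<epsilon>)"
    unfolding eventually_at_right_field by (intro exI[of _ C]) auto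
next
  assume "\<exists>C>0. \<forall>\<^sub>F \<epsilon> in at_right 0. a \<epsilon> \<le> ennreal (C * b \<epsilon>)"
  then obtain C e where "0 < C" "0 < e" "\<forall>\<epsilon>>0. \<epsilon> < e \<longrightarrow> a \<epsilon> \<le> ennreal (C * b \<epsilon>)"
    unfolding eventually_at_right_field by auto
  then show "net_bigo a b"
    \<comment> \<open>The minimum with 1/2 keeps the threshold strictly inside the unit interval, as
      \<open>net_bigo\<close> demands.\<close>
    unfolding net_bigo_def by (intro exI[of _ C] conjI bexI[of _ "min e (1 / 2)"]) auto
qed

lemma net_bigo_mono:
  assumes "net_bigo a b" "\<And>\<epsilon>. 0 < \<epsilon> \<Longrightarrow> b \<epsilon> \<le> b' \<epsilon>"
  shows "net_bigo a b'"
proof -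
  obtain C where "0 < C" and C: "\<forall>\<^sub>F \<epsilon> in at_right 0. a \<epsilon> \<le> ennreal (C * b \<epsilon>)"
    using assms(1) by (auto simp: net_bigo_iff_eventually)
  have "\<forall>\<^sub>F \<epsilon> in at_right 0. a \<epsilon> \<le> ennreal (C * b' \<epsilon>)"
    using C eventually_at_right_less[of 0]
  proof eventually_elim
    case (elim \<epsilon>)
    have "ennreal (C * b \<epsilon>) \<le> ennreal (C * b' \<epsilon>)"
      using assms(2)[OF elim(2)] \<open>0 < C\<close> by (intro ennreal_leI mult_left_mono) auto
    with elim(1) show ?case by (rule order_trans)
  qed
  then show ?thesis using \<open>0 < C\<close> by (auto simp: net_bigo_iff_eventually)
qed

lemma net_bigo_add:
  assumes "net_bigo c b" "net_bigo c' b" "\<And>\<epsilon>. 0 \<le> b \<epsilon>"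
    and a: "\<And>\<epsilon>. \<epsilon> \<in> {0<..<1} \<Longrightarrow> a \<epsilon> \<le> c \<epsilon> + c' \<epsilon>"
  shows "net_bigo a b"
proof -
  obtain C1 C2 where "0 < C1" "0 < C2"
    and C1: "\<forall>\<^sub>F \<epsilon> in at_right 0. c \<epsilon> \<le> ennreal (C1 * b \<epsilon>)"
    and C2: "\<forall>\<^sub>F \<epsilon> in at_right 0. c' \<epsilon> \<le> ennreal (C2 * b \<epsilon>)"
    using assms(1,2) by (auto simp: net_bigo_iff_eventually)
  have "\<forall>\<^sub>F \<epsilon> in at_right 0. \<epsilon> \<in> {0<..<1::real}"
    by (rule eventually_at_right_real) simp
  with C1 C2 have "\<forall>\<^sub>F \<epsilon> in at_right 0. a \<epsilon> \<le> ennreal ((C1 + C2) * b \<epsilon>)"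
  proof eventually_elim
    case (elim \<epsilon>)
    have "a \<epsilon> \<le> ennreal (C1 * b \<epsilon>) + ennreal (C2 * b \<epsilon>)"
      using a[OF elim(3)] elim(1,2) by (meson add_mono order_trans)
    also have "\<dots> = ennreal ((C1 + C2) * b \<epsilon>)"
      using \<open>0 < C1\<close> \<open>0 < C2\<close> assms(3)[of \<epsilon>] by (simp add: ennreal_plus[symmetric] distrib_right del: ennreal_plus)
    finally show ?case .
  qed
  then show ?thesis
    using \<open>0 < C1\<close> \<open>0 < C2\<close> by (auto simp: net_bigo_iff_eventually intro!: exI[of _ "C1 + C2"])
qed

text \<open>The two images are compared element by element, so \<open>net_rel\<close> need not be
  shown to be an equivalence relation; closure of \<open>N\<close> under differences is
  enough.\<close>

lemma net_rel_class_eq_zero: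
  fixes E N :: "'n::finite net set"
  assumes "f \<in> E" "(\<lambda>_ _. 0) \<in> E" "f \<in> N"
    and diff: "\<And>u v. u \<in> N \<Longrightarrow> v \<in> N \<Longrightarrow> (\<lambda>\<epsilon> x. u \<epsilon> x - v \<epsilon> x) \<in> N"
  shows "net_rel E N `` {f} = net_rel E N `` {\<lambda>_ _. 0}"
proof -
  have "(\<lambda>\<epsilon> x. f \<epsilon> x - g \<epsilon> x) \<in> N \<longleftrightarrow> (\<lambda>\<epsilon> x. 0 - g \<epsilon> x) \<in> N" for g
  proof
    assume "(\<lambda>\<epsilon> x. f \<epsilon> x - g \<epsilon> x) \<in> N"
    from diff[OF this assms(3)] show "(\<lambda>\<epsilon> x. 0 - g \<epsilon> x) \<in> N" by simp
  next
    assume g: "(\<lambda>\<epsilon> x. 0 - g \<epsilon> x) \<in> N"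
    \<comment> \<open>Written with differences only: f - g = f - ((f - f) - (0 - g)).\<close>
    from diff[OF assms(3) diff[OF diff[OF assms(3,3)] this]] show "(\<lambda>\<epsilon> x. f \<epsilon> x - g \<epsilon> x) \<in> N" by simp
  qed
  then show ?thesis using assms(1,2) by (auto simp: net_rel_def)
qed

text \<open>Common form of \<open>E_beurling\<close> and \<open>E_roumieu\<close>, with the norms
  indexed by a set of weights. In the definitions of nets and scalars below, the same set also
  indexes the scales in epsilon.\<close>

definition ultradiff :: "(nat \<Rightarrow> real) set \<Rightarrow> (real ^ 'n::finite) set \<Rightarrow> (real ^ 'n \<Rightarrow> complex) set" where
  "ultradiff \<W> \<Omega> = {u \<in> C_infinity \<Omega>. \<forall>S W. regular_compact_in S \<Omega> \<and> W \<in> \<W> \<longrightarrow> weighted_norm W S u < \<infinity>}"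

definition moderate_nets :: "(nat \<Rightarrow> real) set \<Rightarrow> (real ^ 'n::finite) set \<Rightarrow> 'n net set" where
  "moderate_nets \<W> \<Omega> =
     {g. (\<forall>\<epsilon>\<in>{0<..<1}. g \<epsilon> \<in> ultradiff \<W> \<Omega>) \<and>
         (\<forall>S W. regular_compact_in S \<Omega> \<and> W \<in> \<W> \<longrightarrow>
            (\<exists>U\<in>\<W>. net_bigo (\<lambda>\<epsilon>. weighted_norm W S (g \<epsilon>)) (\<lambda>\<epsilon>. exp (assoc_fun U (1 / \<epsilon>)))))}"

definition negligible_nets :: "(nat \<Rightarrow> real) set \<Rightarrow> (real ^ 'n::finite) set \<Rightarrow> 'n net set" where
  "negligible_nets \<W> \<Omega> =
     {g. (\<forall>\<epsilon>\<in>{0<..<1}. g \<epsilon> \<in> ultradiff \<W> \<Omega>) \<and>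
         (\<forall>S W U. regular_compact_in S \<Omega> \<and> W \<in> \<W> \<and> U \<in> \<W> \<longrightarrow>
            net_bigo (\<lambda>\<epsilon>. weighted_norm W S (g \<epsilon>)) (\<lambda>\<epsilon>. exp (- assoc_fun U (1 / \<epsilon>))))}"

definition negligible_scalars :: "(nat \<Rightarrow> real) set \<Rightarrow> (real \<Rightarrow> complex) set" where
  "negligible_scalars \<W> =
     {c. \<forall>U\<in>\<W>. net_bigo (\<lambda>\<epsilon>. ennreal (cmod (c \<epsilon>))) (\<lambda>\<epsilon>. exp (- assoc_fun U (1 / \<epsilon>)))}"

context weight_family
begin

lemma negligible_nets_diff:
  assumes "open \<Omega>" "u \<in> negligible_nets \<W> \<Omega>" "v \<in> negligible_nets \<W> \<Omega>"
  shows "(\<lambda>\<epsilon> x. u \<epsilon> x - v \<epsilon> x) \<in> negligible_nets \<W> \<Omega>"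
proof -
  have C: "u \<epsilon> \<in> C_infinity \<Omega>" "v \<epsilon> \<in> C_infinity \<Omega>" if "\<epsilon> \<in> {0<..<1}" for \<epsilon>
    using assms(2,3) that by (auto simp: negligible_nets_def ultradiff_def)
  have le: "weighted_norm W S (\<lambda>x. u \<epsilon> x - v \<epsilon> x) \<le> weighted_norm W S (u \<epsilon>) + weighted_norm W S (v \<epsilon>)"
    if "\<epsilon> \<in> {0<..<1}" "W \<in> \<W>" "regular_compact_in S \<Omega>" for \<epsilon> W S
    using that by (intro weighted_norm_diff[OF assms(1) C]) (auto simp: regular_compact_in_def weight_pos)
  have "(\<lambda>x. u \<epsilon> x - v \<epsilon> x) \<in> ultradiff \<W> \<Omega>" if "\<epsilon> \<in> {0<..<1}" for \<epsilon>
    unfolding ultradiff_def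
  proof (intro CollectI conjI allI impI)
    show "(\<lambda>x. u \<epsilon> x - v \<epsilon> x) \<in> C_infinity \<Omega>"
      by (intro C_infinity_diff assms C that)
    fix S W assume SW: "regular_compact_in S \<Omega> \<and> W \<in> \<W>"
    then have "weighted_norm W S (u \<epsilon>) < \<infinity>" "weighted_norm W S (v \<epsilon>) < \<infinity>"
      using assms(2,3) that by (auto simp: negligible_nets_def ultradiff_def)
    with le[OF that, of W S] SW show "weighted_norm W S (\<lambda>x. u \<epsilon> x - v \<epsilon> x) < \<infinity>"
      by (auto intro: le_less_trans)
  qed
  moreover have "net_bigo (\<lambda>\<epsilon>. weighted_norm W S (\<lambda>x. u \<epsilon> x - v \<epsilon> x)) (\<lambda>\<epsilon>. exp (- assoc_fun U (1 / \<epsilon>)))"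
    if "regular_compact_in S \<Omega>" "W \<in> \<W>" "U \<in> \<W>" for S W U
  proof (rule net_bigo_add)
    show "net_bigo (\<lambda>\<epsilon>. weighted_norm W S (u \<epsilon>)) (\<lambda>\<epsilon>. exp (- assoc_fun U (1 / \<epsilon>)))"
      "net_bigo (\<lambda>\<epsilon>. weighted_norm W S (v \<epsilon>)) (\<lambda>\<epsilon>. exp (- assoc_fun U (1 / \<epsilon>)))"
      using assms(2,3) that by (auto simp: negligible_nets_def)
  qed (use le that in auto)
  ultimately show ?thesis by (auto simp: negligible_nets_def)
qed

lemma zero_moderate:
  fixes \<Omega> :: "(real ^ 'n::finite) set"
  shows "(\<lambda>_ _. 0) \<in> moderate_nets \<W> \<Omega>"
proof -
  have 0: "weighted_norm W S (\<lambda>_. 0) = 0" if "W \<in> \<W>" for W and S :: "(real ^ 'n) set"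
    using weighted_norm_le[OF weight_pos[OF that] test_fun_smooth[OF test_fun_zero(1)]
        test_fun_zero(2)[OF order_refl weight_pos[OF that]], where S = S] by simp
  moreover have "(\<lambda>_. 0) \<in> C_infinity \<Omega>"
    by (rule test_fun_imp_C_infinity[of "{}"]) (simp_all add: test_fun_zero)
  ultimately show ?thesis
    by (auto simp: moderate_nets_def ultradiff_def net_bigo_iff_eventually intro: zero_less_one)
qed

text \<open>Translates the estimate for test functions into nets on \<open>\<Omega>\<close>: the
  support condition turns norms on \<open>K\<close> into global derivative bounds and back.\<close>

lemma class_eq_zero_if_weakly_negligible:
  fixes f :: "'n::finite net"
  assumes "open \<Omega>" and K: "regular_compact_in K \<Omega>"
    and f: "f \<in> moderate_nets \<W> \<Omega>" and supp: "\<And>\<epsilon>. \<epsilon> \<in> {0<..<1} \<Longrightarrow> supp \<Omega> (f \<epsilon>) \<subseteq> K"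
    and V: "V \<in> \<W>"
    and weak: "\<And>\<phi>. \<phi> \<in> C_infinity \<Omega> \<Longrightarrow> supp \<Omega> \<phi> \<subseteq> K \<Longrightarrow> weighted_norm V K \<phi> < \<infinity> \<Longrightarrow>
      (\<lambda>\<epsilon>. LINT x|lborel. f \<epsilon> x * \<phi> x) \<in> negligible_scalars \<W>"
  shows "net_rel (moderate_nets \<W> \<Omega>) (negligible_nets \<W> \<Omega>) `` {f}
    = net_rel (moderate_nets \<W> \<Omega>) (negligible_nets \<W> \<Omega>) `` {\<lambda>_ _. 0}"
proof (rule net_rel_class_eq_zero[OF f zero_moderate _ negligible_nets_diff[OF assms(1)]])
  have cK: "compact K" "closed K" "K \<subseteq> \<Omega>"
    using K by (auto simp: regular_compact_in_def compact_imp_closed)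
  have test: "test_fun K (f \<epsilon>)" if "\<epsilon> \<in> {0<..<1}" for \<epsilon>
    using f that by (intro C_infinity_imp_test_fun[OF assms(1) cK(2,3) _ supp])
      (auto simp: moderate_nets_def ultradiff_def)
  have in01: "\<forall>\<^sub>F \<epsilon> in at_right 0. \<epsilon> \<in> {0<..<1::real}"
    by (rule eventually_at_right_real) simp
  have neg: "\<exists>C>0. \<forall>\<^sub>F \<epsilon> in at_right 0. deriv_bound W (C * exp (- assoc_fun X (1 / \<epsilon>))) (f \<epsilon>)"
    if "W \<in> \<W>" "X \<in> \<W>" for W X
  proof (rule negligible_if_weakly_negligible[OF cK(1) test _ V _ that])
    fix W assume W: "W \<in> \<W>"
    then obtain U where "U \<in> \<W>"
      and "net_bigo (\<lambda>\<epsilon>. weighted_norm W K (f \<epsilon>)) (\<lambda>\<epsilon>. exp (assoc_fun U (1 / \<epsilon>)))"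
      using f K unfolding moderate_nets_def by blast
    then obtain C where "0 < C"
      and C: "\<forall>\<^sub>F \<epsilon> in at_right 0. weighted_norm W K (f \<epsilon>) \<le> ennreal (C * exp (assoc_fun U (1 / \<epsilon>)))"
      unfolding net_bigo_iff_eventually by blast
    from C in01 have "\<forall>\<^sub>F \<epsilon> in at_right 0. deriv_bound W (C * exp (assoc_fun U (1 / \<epsilon>))) (f \<epsilon>)"
      by eventually_elim
        (use \<open>0 < C\<close> in \<open>auto intro!: deriv_bound_if_weighted_norm_le[OF weight_pos[OF W] cK(2) test]\<close>)
    with \<open>U \<in> \<W>\<close> \<open>0 < C\<close> show "\<exists>U\<in>\<W>. \<exists>C>0.
        \<forall>\<^sub>F \<epsilon> in at_right 0. deriv_bound W (C * exp (assoc_fun U (1 / \<epsilon>))) (f \<epsilon>)" by blast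
  next
    fix u :: "real ^ 'n \<Rightarrow> complex" and B Z
    assume u: "test_fun K u" "deriv_bound V B u" and Z: "Z \<in> \<W>"
    have "weighted_norm V K u \<le> ennreal B"
      by (rule weighted_norm_le[OF weight_pos[OF V] test_fun_smooth[OF u(1)] u(2)])
    then have "weighted_norm V K u < \<infinity>"
      by (rule le_less_trans) simp
    then have "(\<lambda>\<epsilon>. LINT x|lborel. f \<epsilon> x * u x) \<in> negligible_scalars \<W>"
      by (intro weak test_fun_imp_C_infinity[OF cK(2,3) u(1)])
    then obtain C where "0 < C" "\<forall>\<^sub>F \<epsilon> in at_right 0.
        ennreal (cmod (LINT x|lborel. f \<epsilon> x * u x)) \<le> ennreal (C * exp (- assoc_fun Z (1 / \<epsilon>)))"
      using Z by (auto simp: negligible_scalars_def net_bigo_iff_eventually)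
    then show "\<exists>C. \<forall>\<^sub>F \<epsilon> in at_right 0.
        cmod (LINT x|lborel. f \<epsilon> x * u x) \<le> C * exp (- assoc_fun Z (1 / \<epsilon>))"
      by (intro exI[of _ C]) simp
  qed
  have "net_bigo (\<lambda>\<epsilon>. weighted_norm W S (f \<epsilon>)) (\<lambda>\<epsilon>. exp (- assoc_fun U (1 / \<epsilon>)))"
    if "W \<in> \<W>" "U \<in> \<W>" for S W U
  proof -
    obtain C where "0 < C"
      and C: "\<forall>\<^sub>F \<epsilon> in at_right 0. deriv_bound W (C * exp (- assoc_fun U (1 / \<epsilon>))) (f \<epsilon>)"
      using neg[OF \<open>W \<in> \<W>\<close> \<open>U \<in> \<W>\<close>] by blast
    from C in01 have "\<forall>\<^sub>F \<epsilon> in at_right 0. weighted_norm W S (f \<epsilon>) \<le> ennreal (C * exp (- assoc_fun U (1 / \<epsilon>)))"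
      by eventually_elim (rule weighted_norm_le[OF weight_pos[OF \<open>W \<in> \<W>\<close>] test_fun_smooth[OF test]])
    with \<open>0 < C\<close> show ?thesis by (auto simp: net_bigo_iff_eventually)
  qed
  then show "f \<in> negligible_nets \<W> \<Omega>"
    using f by (auto simp: negligible_nets_def moderate_nets_def)
qed

end

section \<open>Beurling and Roumieu weights\<close>

lemma weight_sequenceD:
  assumes "weight_sequence M"
  shows "0 < M p" "M 0 = 1"
    and "\<exists>c H. 1 \<le> c \<and> 1 \<le> H \<and> (\<forall>p q. M (p + q) \<le> c * H ^ (p + q) * (M p * M q))"
proof -
  show "0 < M p" "M 0 = 1" using assms by (auto simp: weight_sequence_def)
  from assms obtain c H where "1 \<le> c" "1 \<le> H"
    and M2: "\<And>p. M p \<le> c * H ^ p * Min ((\<lambda>q. M (p - q) * M q) ` {0..p})"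
    unfolding weight_sequence_def by blast
  have "M (p + q) \<le> c * H ^ (p + q) * (M p * M q)" for p q
  proof -
    \<comment> \<open>(M.2) bounds by the best splitting of p + q; the member with index
      \<open>q\<close> is the one wanted.\<close>
    have "Min ((\<lambda>r. M (p + q - r) * M r) ` {0..p + q}) \<le> M p * M q"
      by (intro Min_le) (auto intro!: image_eqI[of _ _ q])
    then have "c * H ^ (p + q) * Min ((\<lambda>r. M (p + q - r) * M r) ` {0..p + q}) \<le> c * H ^ (p + q) * (M p * M q)"
      using \<open>1 \<le> c\<close> \<open>1 \<le> H\<close> by (intro mult_left_mono) auto
    with M2[of "p + q"] show ?thesis by (rule order_trans)
  qed
  then show "\<exists>c H. 1 \<le> c \<and> 1 \<le> H \<and> (\<forall>p q. M (p + q) \<le> c * H ^ (p + q) * (M p * M q))"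
    using \<open>1 \<le> c\<close> \<open>1 \<le> H\<close> by blast
qed

text \<open>Replacing \<open>h\<close> by \<open>h / H\<close> absorbs the factor H^(p+q) of (M.2),
  and the smaller of two parameters gives a common lower weight.\<close>

lemma weight_family_beurling:
  assumes M: "weight_sequence M"
  shows "weight_family (beurling_weight M ` {0<..})"
proof
  note Mpos = weight_sequenceD(1)[OF M]
  fix U W assume "U \<in> beurling_weight M ` {0<..}" and "W \<in> beurling_weight M ` {0<..}"
  then obtain k h where k: "0 < k" "U = beurling_weight M k" and h: "0 < h" "W = beurling_weight M h"
    by auto
  show "0 < W p" for p using h Mpos by (simp add: beurling_weight_def)
  show "W 0 = 1" using h weight_sequenceD(2)[OF M] by (simp add: beurling_weight_def)
  have "(\<lambda>p. 1 / h * (M p / M (Suc p))) \<longlonglongrightarrow> 1 / h * 0"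
    by (intro tendsto_mult tendsto_const weight_sequence_ratio_tendsto M)
  then show "(\<lambda>p. W p / W (Suc p)) \<longlonglongrightarrow> 0"
    using h by (simp add: beurling_weight_def divide_simps mult_ac)
  obtain c H where cH: "1 \<le> c" "1 \<le> H" "\<And>p q. M (p + q) \<le> c * H ^ (p + q) * (M p * M q)"
    using weight_sequenceD(3)[OF M] by blast
  have "beurling_weight M (h / H) (p + q) \<le> c * (W p * W q)" for p q
  proof -
    have "(h / H) ^ (p + q) * M (p + q) \<le> (h / H) ^ (p + q) * (c * H ^ (p + q) * (M p * M q))"
      using h cH by (intro mult_left_mono) auto
    also have "\<dots> = c * (h ^ p * M p * (h ^ q * M q))"
      using cH by (simp add: power_divide power_add)
    finally show ?thesis by (simp add: beurling_weight_def h)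
  qed
  then show "\<exists>U\<in>beurling_weight M ` {0<..}. \<exists>C. \<forall>p q. U (p + q) \<le> C * (W p * W q)"
    using h cH by (intro bexI[of _ "beurling_weight M (h / H)"] exI[of _ c]) auto
  have "min h k ^ p * M p \<le> k ^ p * M p \<and> min h k ^ p * M p \<le> h ^ p * M p" for p
    using h k Mpos[of p] by (auto intro!: mult_right_mono power_mono)
  then show "\<exists>Z\<in>beurling_weight M ` {0<..}. \<forall>p. Z p \<le> U p \<and> Z p \<le> W p"
    using h k by (intro bexI[of _ "beurling_weight M (min h k)"]) (auto simp: beurling_weight_def)
qed

text \<open>The left side runs through r 1, r 1, r 2, r 2, and so on. Its last factor has index (p +
  q + 1) div 2, which is at most the larger of p and q, so it can be matched with the last factor of
  the longer product and both removed.\<close>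

lemma prod_halved_index_le:
  fixes r :: "nat \<Rightarrow> real"
  assumes pos: "\<And>i. 1 \<le> i \<Longrightarrow> 0 < r i" and mono: "mono_on {1..} r"
  shows "(\<Prod>i = 1..p + q. r ((i + 1) div 2)) \<le> (\<Prod>i = 1..p. r i) * (\<Prod>i = 1..q. r i)"
proof (induction "p + q" arbitrary: p q)
  case (Suc n)
  have *: "(\<Prod>i = 1..p + q. r ((i + 1) div 2)) \<le> (\<Prod>i = 1..p. r i) * (\<Prod>i = 1..q. r i)"
    if pq: "Suc n = p + q" "q \<le> p" for p q
  proof -
    obtain p' where p': "p = Suc p'" using pq by (cases p) auto
    have "(\<Prod>i = 1..p + q. r ((i + 1) div 2)) = (\<Prod>i = 1..p' + q. r ((i + 1) div 2)) * r ((p + q + 1) div 2)"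
      by (simp add: p')
    also have "\<dots> \<le> ((\<Prod>i = 1..p'. r i) * (\<Prod>i = 1..q. r i)) * r p"
    proof (rule mult_mono)
      show "(\<Prod>i = 1..p' + q. r ((i + 1) div 2)) \<le> (\<Prod>i = 1..p'. r i) * (\<Prod>i = 1..q. r i)"
        using Suc.hyps(1)[of p' q] pq by (simp add: p')
      show "r ((p + q + 1) div 2) \<le> r p"
        using pq by (intro mono_onD[OF mono]) (auto simp: p')
      show "0 \<le> r ((p + q + 1) div 2)"
        by (rule less_imp_le[OF pos]) (simp add: p')
      show "0 \<le> (\<Prod>i = 1..p'. r i) * (\<Prod>i = 1..q. r i)"
        by (intro mult_nonneg_nonneg prod_nonneg) (simp_all add: less_imp_le pos)
    qed
    finally show ?thesis by (simp add: p' mult_ac)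
  qed
  show ?case
  proof (cases "q \<le> p")
    case True
    then show ?thesis using * Suc.hyps(2) by blast
  next
    case False
    then show ?thesis using *[of q p] Suc.hyps(2) by (simp add: add.commute mult.commute)
  qed
qed simp

text \<open>For increasing \<open>r\<close> the product up to p + q dominates the product of the two
  shorter ones, which is the wrong direction, and rescaling by a constant need not repair this. The
  sequence is therefore slowed down by doubling its entries, and division by \<open>H\<close>
  absorbs the factor of (M.2). Pointwise minima stay in \<open>seqs_R\<close> and give a common
  lower weight.\<close>

lemma weight_family_roumieu:
  assumes M: "weight_sequence M"
  shows "weight_family (roumieu_weight M ` seqs_R)"
proof
  note Mpos = weight_sequenceD(1)[OF M]
  fix U W assume "U \<in> roumieu_weight M ` seqs_R" and "W \<in> roumieu_weight M ` seqs_R"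
  then obtain k r where k: "k \<in> seqs_R" "U = roumieu_weight M k" and r: "r \<in> seqs_R" "W = roumieu_weight M r"
    by auto
  have kr_pos: "0 < k i" "0 < r i" if "1 \<le> i" for i
    using k(1) r(1) that by (auto simp: seqs_R_def)
  have kr_mono: "mono_on {1..} k" "mono_on {1..} r"
    using k(1) r(1) by (auto simp: seqs_R_def)
  have kr_lim: "filterlim k at_top sequentially" "filterlim r at_top sequentially"
    using k(1) r(1) by (auto simp: seqs_R_def)
  show "0 < W p" for p
    unfolding r(2) roumieu_weight_def by (intro mult_pos_pos Mpos prod_pos) (auto intro: kr_pos)
  show "W 0 = 1" using r weight_sequenceD(2)[OF M] by (simp add: roumieu_weight_def)
  show "(\<lambda>p. W p / W (Suc p)) \<longlonglongrightarrow> 0"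
    unfolding r(2) by (rule roumieu_weight_ratio_tendsto[OF M r(1)])
  obtain c H where cH: "1 \<le> c" "1 \<le> H" "\<And>p q. M (p + q) \<le> c * H ^ (p + q) * (M p * M q)"
    using weight_sequenceD(3)[OF M] by blast
  \<comment> \<open>repeating each entry keeps \<open>\<Prod>i\<le>p + q. s i\<close> below the product for the most balanced splitting of \<open>p + q\<close>\<close>
  define s where "s i = r ((i + 1) div 2) / H" for i
  have "s \<in> seqs_R"
    unfolding seqs_R_def
  proof (intro CollectI conjI allI impI)
    show "0 < s i" if "1 \<le> i" for i
      using that cH kr_pos(2)[of "(i + 1) div 2"] by (simp add: s_def)
    show "mono_on {1..} s"
      using cH by (intro mono_onI) (auto simp: s_def intro!: divide_right_mono mono_onD[OF kr_mono(2)] div_le_mono)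
    have "filterlim (\<lambda>i. (i + 1) div 2) at_top (sequentially :: nat filter)"
      unfolding filterlim_at_top
    proof
      fix Z :: nat
      show "\<forall>\<^sub>F i in sequentially. Z \<le> (i + 1) div 2"
        unfolding eventually_sequentially by (intro exI[of _ "2 * Z"]) auto
    qed
    from filterlim_compose[OF kr_lim(2) this]
    have "filterlim (\<lambda>i. 1 / H * r ((i + 1) div 2)) at_top sequentially"
      using cH(2) by (intro filterlim_tendsto_pos_mult_at_top[OF tendsto_const]) auto
    then show "filterlim s at_top sequentially" by (simp add: s_def[abs_def])
  qed
  moreover have "roumieu_weight M s (p + q) \<le> c * (W p * W q)" for p q
  proof -
    have "(\<Prod>i = 1..p + q. s i) * H ^ (p + q) = (\<Prod>i = 1..p + q. r ((i + 1) div 2))"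
      using cH by (simp add: s_def prod_dividef)
    also have "\<dots> \<le> (\<Prod>i = 1..p. r i) * (\<Prod>i = 1..q. r i)"
      by (rule prod_halved_index_le[OF kr_pos(2) kr_mono(2)])
    finally have P: "(\<Prod>i = 1..p + q. s i) * H ^ (p + q) \<le> (\<Prod>i = 1..p. r i) * (\<Prod>i = 1..q. r i)" .
    have "0 \<le> (\<Prod>i = 1..p + q. s i)"
      using \<open>s \<in> seqs_R\<close> by (intro prod_nonneg) (auto simp: seqs_R_def intro: less_imp_le)
    then have "M (p + q) * (\<Prod>i = 1..p + q. s i) \<le> c * H ^ (p + q) * (M p * M q) * (\<Prod>i = 1..p + q. s i)"
      by (intro mult_right_mono cH)
    also have "\<dots> = c * (M p * M q) * ((\<Prod>i = 1..p + q. s i) * H ^ (p + q))" by simp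
    also have "\<dots> \<le> c * (M p * M q) * ((\<Prod>i = 1..p. r i) * (\<Prod>i = 1..q. r i))"
      using cH(1) Mpos[of p] Mpos[of q] by (intro mult_left_mono P) auto
    finally show ?thesis by (simp add: roumieu_weight_def r(2) mult_ac)
  qed
  ultimately show "\<exists>U\<in>roumieu_weight M ` seqs_R. \<exists>C. \<forall>p q. U (p + q) \<le> C * (W p * W q)"
    by (intro bexI[of _ "roumieu_weight M s"] exI[of _ c]) auto
  define m where "m i = min (k i) (r i)" for i
  have "m \<in> seqs_R"
    unfolding seqs_R_def
  proof (intro CollectI conjI allI impI)
    show "0 < m i" if "1 \<le> i" for i
      using kr_pos[OF that] by (simp add: m_def)
    show "mono_on {1..} m"
      unfolding m_def
      by (intro mono_onI min.mono mono_onD[OF kr_mono(1)] mono_onD[OF kr_mono(2)])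
    show "filterlim m at_top sequentially"
      using kr_lim unfolding filterlim_at_top m_def by (auto intro: eventually_conj)
  qed
  moreover have "roumieu_weight M m p \<le> U p \<and> roumieu_weight M m p \<le> W p" for p
    unfolding roumieu_weight_def k(2) r(2)
    by (intro conjI mult_left_mono prod_mono) (auto simp: m_def less_imp_le kr_pos Mpos)
  ultimately show "\<exists>Z\<in>roumieu_weight M ` seqs_R. \<forall>p. Z p \<le> U p \<and> Z p \<le> W p"
    by (intro bexI[of _ "roumieu_weight M m"]) auto
qed

section \<open>Identification of the Beurling and Roumieu spaces with the general ones\<close>

lemma assoc_fun_beurling_weight:
  assumes "0 < h" "0 < \<epsilon>"
  shows "assoc_fun (beurling_weight M h) (1 / \<epsilon>) = assoc_fun M (1 / h / \<epsilon>)"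
proof -
  have "(1 / \<epsilon>) ^ p / beurling_weight M h p = (1 / h / \<epsilon>) ^ p / M p" for p
    using assms by (simp add: beurling_weight_def power_divide field_simps)
  then show ?thesis by (simp add: assoc_fun_def)
qed

lemma net_bigo_cong:
  assumes "\<And>\<epsilon>. 0 < \<epsilon> \<Longrightarrow> b \<epsilon> = b' \<epsilon>"
  shows "net_bigo a b \<longleftrightarrow> net_bigo a b'"
  using net_bigo_mono[of a b b'] net_bigo_mono[of a b' b] assms by auto

lemma E_beurling_eq: "E_beurling M \<Omega> = ultradiff (beurling_weight M ` {0<..}) \<Omega>"
  by (auto simp: E_beurling_def ultradiff_def)

lemma net_bigo_beurling_weight:
  assumes "0 < h"
  shows "net_bigo a (\<lambda>\<epsilon>. exp (assoc_fun (beurling_weight M h) (1 / \<epsilon>)))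
      \<longleftrightarrow> net_bigo a (\<lambda>\<epsilon>. exp (assoc_fun M (1 / h / \<epsilon>)))"
    and "net_bigo a (\<lambda>\<epsilon>. exp (- assoc_fun (beurling_weight M h) (1 / \<epsilon>)))
      \<longleftrightarrow> net_bigo a (\<lambda>\<epsilon>. exp (- assoc_fun M (1 / h / \<epsilon>)))"
  using assms by (auto intro!: net_bigo_cong simp: assoc_fun_beurling_weight)

lemma ball_inverse_pos: "(\<forall>h\<in>{0<..}. P (1 / h)) \<longleftrightarrow> (\<forall>k>0. P (k::real))"
proof
  assume *: "\<forall>h\<in>{0<..}. P (1 / h)"
  show "\<forall>k>0. P k"
  proof (intro allI impI)
    fix k :: real assume "0 < k"
    with *[THEN bspec, of "1 / k"] show "P k" by simp
  qed
qed simp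

lemma assoc_fun_weight_sequence_nonneg:
  assumes "weight_sequence M" "0 \<le> \<rho>"
  shows "0 \<le> assoc_fun M \<rho>"
  using assms by (intro assoc_fun_nonneg weight_sequence_ratio_tendsto weight_sequenceD(1))

lemma EM_beurling_eq:
  assumes M: "weight_sequence M"
  shows "EM_beurling M \<Omega> = moderate_nets (beurling_weight M ` {0<..}) \<Omega>"
proof -
  have "(\<exists>k\<ge>0. net_bigo a (\<lambda>\<epsilon>. exp (assoc_fun M (k / \<epsilon>))))
      \<longleftrightarrow> (\<exists>h\<in>{0<..}. net_bigo a (\<lambda>\<epsilon>. exp (assoc_fun M (1 / h / \<epsilon>))))" for a
  proof
    assume "\<exists>k\<ge>0. net_bigo a (\<lambda>\<epsilon>. exp (assoc_fun M (k / \<epsilon>)))"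
    then obtain k where k: "0 \<le> k" "net_bigo a (\<lambda>\<epsilon>. exp (assoc_fun M (k / \<epsilon>)))" by blast
    show "\<exists>h\<in>{0<..}. net_bigo a (\<lambda>\<epsilon>. exp (assoc_fun M (1 / h / \<epsilon>)))"
    \<comment> \<open>The value k = 0 corresponds to no h = 1/k. It means boundedness, which implies
      the estimate with k = 1 because the associated function is nonnegative.\<close>
    proof (cases "k = 0")
      case True
      then have "net_bigo a (\<lambda>\<epsilon>. exp (assoc_fun M (1 / 1 / \<epsilon>)))"
        using k(2) M by (elim net_bigo_mono)
          (simp add: assoc_fun_zero weight_sequenceD assoc_fun_weight_sequence_nonneg)
      then show ?thesis by (intro bexI[of _ 1]) auto
    next
      case False
      then show ?thesis using k by (intro bexI[of _ "1 / k"]) auto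
    qed
  next
    assume "\<exists>h\<in>{0<..}. net_bigo a (\<lambda>\<epsilon>. exp (assoc_fun M (1 / h / \<epsilon>)))"
    then obtain h where "0 < h" "net_bigo a (\<lambda>\<epsilon>. exp (assoc_fun M (1 / h / \<epsilon>)))" by auto
    then show "\<exists>k\<ge>0. net_bigo a (\<lambda>\<epsilon>. exp (assoc_fun M (k / \<epsilon>)))"
      by (intro exI[of _ "1 / h"]) simp
  qed
  then show ?thesis
    by (auto simp: EM_beurling_def moderate_nets_def E_beurling_eq net_bigo_beurling_weight)
qed

lemma N_beurling_eq:
  assumes M: "weight_sequence M"
  shows "N_beurling M \<Omega> = negligible_nets (beurling_weight M ` {0<..}) \<Omega>"
proof -
  have "(\<forall>k\<ge>0. net_bigo a (\<lambda>\<epsilon>. exp (- assoc_fun M (k / \<epsilon>))))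
      \<longleftrightarrow> (\<forall>h\<in>{0<..}. net_bigo a (\<lambda>\<epsilon>. exp (- assoc_fun M (1 / h / \<epsilon>))))" (is "?L \<longleftrightarrow> ?R") for a
  proof
    assume ?R
    then have pos: "net_bigo a (\<lambda>\<epsilon>. exp (- assoc_fun M (k / \<epsilon>)))" if "0 < k" for k
      using that ball_inverse_pos[of "\<lambda>k. net_bigo a (\<lambda>\<epsilon>. exp (- assoc_fun M (k / \<epsilon>)))"] by blast
    \<comment> \<open>For k = 0 the scale is constantly 1, and boundedness follows from the decay
      for k = 1.\<close>
    have "net_bigo a (\<lambda>\<epsilon>. exp (- assoc_fun M (0 / \<epsilon>)))"
      by (rule net_bigo_mono[OF pos[OF zero_less_one]])
        (simp add: M assoc_fun_zero weight_sequenceD assoc_fun_weight_sequence_nonneg)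
    with pos show ?L by (metis order_le_less)
  next
    assume ?L
    then show ?R
      using ball_inverse_pos[of "\<lambda>k. net_bigo a (\<lambda>\<epsilon>. exp (- assoc_fun M (k / \<epsilon>)))"] by auto
  qed
  then have "(\<forall>S h k. regular_compact_in S \<Omega> \<and> 0 < h \<and> 0 \<le> k \<longrightarrow>
        net_bigo (\<lambda>\<epsilon>. weighted_norm (beurling_weight M h) S (g \<epsilon>)) (\<lambda>\<epsilon>. exp (- assoc_fun M (k / \<epsilon>))))
    \<longleftrightarrow> (\<forall>S h k. regular_compact_in S \<Omega> \<and> 0 < h \<and> 0 < k \<longrightarrow>
        net_bigo (\<lambda>\<epsilon>. weighted_norm (beurling_weight M h) S (g \<epsilon>))
          (\<lambda>\<epsilon>. exp (- assoc_fun M (1 / k / \<epsilon>))))" for g :: "'a net"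
    by (metis greaterThan_iff)
  moreover have "(\<forall>S W U. regular_compact_in S \<Omega> \<and> W \<in> beurling_weight M ` {0<..} \<and> U \<in> beurling_weight M ` {0<..} \<longrightarrow>
        net_bigo (\<lambda>\<epsilon>. weighted_norm W S (g \<epsilon>)) (\<lambda>\<epsilon>. exp (- assoc_fun U (1 / \<epsilon>))))
    \<longleftrightarrow> (\<forall>S h k. regular_compact_in S \<Omega> \<and> 0 < h \<and> 0 < k \<longrightarrow>
        net_bigo (\<lambda>\<epsilon>. weighted_norm (beurling_weight M h) S (g \<epsilon>))
          (\<lambda>\<epsilon>. exp (- assoc_fun M (1 / k / \<epsilon>))))" for g :: "'a net"
  proof (intro iffI allI impI; elim conjE)
    fix S and h k :: real
    assume *: "\<forall>S W U. regular_compact_in S \<Omega> \<and> W \<in> beurling_weight M ` {0<..} \<and> U \<in> beurling_weight M ` {0<..} \<longrightarrow>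
        net_bigo (\<lambda>\<epsilon>. weighted_norm W S (g \<epsilon>)) (\<lambda>\<epsilon>. exp (- assoc_fun U (1 / \<epsilon>)))"
      and "regular_compact_in S \<Omega>" "0 < h" "0 < k"
    then show "net_bigo (\<lambda>\<epsilon>. weighted_norm (beurling_weight M h) S (g \<epsilon>)) (\<lambda>\<epsilon>. exp (- assoc_fun M (1 / k / \<epsilon>)))"
      unfolding net_bigo_beurling_weight(2)[OF \<open>0 < k\<close>, symmetric] by blast
  next
    fix S W U
    assume *: "\<forall>S h k. regular_compact_in S \<Omega> \<and> 0 < h \<and> 0 < k \<longrightarrow>
        net_bigo (\<lambda>\<epsilon>. weighted_norm (beurling_weight M h) S (g \<epsilon>)) (\<lambda>\<epsilon>. exp (- assoc_fun M (1 / k / \<epsilon>)))"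
      and S: "regular_compact_in S \<Omega>" and "W \<in> beurling_weight M ` {0<..}" "U \<in> beurling_weight M ` {0<..}"
    then obtain h k where "0 < h" "0 < k" "W = beurling_weight M h" "U = beurling_weight M k" by auto
    with S * show "net_bigo (\<lambda>\<epsilon>. weighted_norm W S (g \<epsilon>)) (\<lambda>\<epsilon>. exp (- assoc_fun U (1 / \<epsilon>)))"
      by (simp only: net_bigo_beurling_weight)
  qed
  ultimately show ?thesis
    by (simp only: N_beurling_def negligible_nets_def E_beurling_eq)
qed

lemma NC_beurling_eq: "NC_beurling M = negligible_scalars (beurling_weight M ` {0<..})"
  unfolding NC_beurling_def negligible_scalars_def
  by (simp add: ball_inverse_pos[symmetric] net_bigo_beurling_weight)

lemma roumieu_eq:
  "EM_roumieu M \<Omega> = moderate_nets (roumieu_weight M ` seqs_R) \<Omega>"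
  "N_roumieu M \<Omega> = negligible_nets (roumieu_weight M ` seqs_R) \<Omega>"
  "NC_roumieu M = negligible_scalars (roumieu_weight M ` seqs_R)"
  by (auto simp: EM_roumieu_def N_roumieu_def NC_roumieu_def E_roumieu_def moderate_nets_def
      negligible_nets_def negligible_scalars_def ultradiff_def assoc_fun_R_def)

theorem theorem4:
  fixes \<Omega> K :: "(real ^ 'n::finite) set" and M :: "nat \<Rightarrow> real"
  assumes "open \<Omega>"
    and "weight_sequence M"
    and "regular_compact_in K \<Omega>"
  shows
    "(\<forall>f \<in> G_beurling M \<Omega>. \<forall>f\<^sub>\<epsilon> \<in> EM_beurling M \<Omega>.
        f = class_beurling M \<Omega> f\<^sub>\<epsilon> \<and>
        (\<forall>\<epsilon>\<in>{0<..<1}. supp \<Omega> (f\<^sub>\<epsilon> \<epsilon>) \<subseteq> K) \<and>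
        (\<exists>r>0. \<forall>\<phi>\<in>D_beurling M \<Omega> r K. (\<lambda>\<epsilon>. LINT x|lborel. f\<^sub>\<epsilon> \<epsilon> x * \<phi> x) \<in> NC_beurling M)
        \<longrightarrow> f = zero_beurling M \<Omega>) \<and>
     (\<forall>f \<in> G_roumieu M \<Omega>. \<forall>f\<^sub>\<epsilon> \<in> EM_roumieu M \<Omega>.
        f = class_roumieu M \<Omega> f\<^sub>\<epsilon> \<and>
        (\<forall>\<epsilon>\<in>{0<..<1}. supp \<Omega> (f\<^sub>\<epsilon> \<epsilon>) \<subseteq> K) \<and>
        (\<exists>r\<in>seqs_R. \<forall>\<phi>\<in>D_roumieu M \<Omega> r K. (\<lambda>\<epsilon>. LINT x|lborel. f\<^sub>\<epsilon> \<epsilon> x * \<phi> x) \<in> NC_roumieu M)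
        \<longrightarrow> f = zero_roumieu M \<Omega>)"
proof (intro conjI ballI impI; elim conjE bexE exE)
  fix f f\<^sub>\<epsilon> r
  assume f: "f\<^sub>\<epsilon> \<in> EM_beurling M \<Omega>" "f = class_beurling M \<Omega> f\<^sub>\<epsilon>"
    and supp: "\<forall>\<epsilon>\<in>{0<..<1}. supp \<Omega> (f\<^sub>\<epsilon> \<epsilon>) \<subseteq> K" and "0 < r"
    and weak: "\<forall>\<phi>\<in>D_beurling M \<Omega> r K. (\<lambda>\<epsilon>. LINT x|lborel. f\<^sub>\<epsilon> \<epsilon> x * \<phi> x) \<in> NC_beurling M"
  interpret weight_family "beurling_weight M ` {0<..}"
    by (rule weight_family_beurling[OF assms(2)])
  show "f = zero_beurling M \<Omega>"
    unfolding f(2) class_beurling_def zero_beurling_def rel_beurling_def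
      EM_beurling_eq[OF assms(2)] N_beurling_eq[OF assms(2)]
    \<comment> \<open>The given \<open>r\<close> enters as the single weight \<open>V\<close>:
      \<open>D_beurling M \<Omega> r K\<close> is exactly its test space.\<close>
    by (rule class_eq_zero_if_weakly_negligible[OF assms(1,3), of _ "beurling_weight M r"])
      (use f(1) supp weak \<open>0 < r\<close> in
        \<open>auto simp: EM_beurling_eq[OF assms(2)] NC_beurling_eq D_beurling_def\<close>)
next
  fix f f\<^sub>\<epsilon> r
  assume f: "f\<^sub>\<epsilon> \<in> EM_roumieu M \<Omega>" "f = class_roumieu M \<Omega> f\<^sub>\<epsilon>"
    and supp: "\<forall>\<epsilon>\<in>{0<..<1}. supp \<Omega> (f\<^sub>\<epsilon> \<epsilon>) \<subseteq> K" and "r \<in> seqs_R"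
    and weak: "\<forall>\<phi>\<in>D_roumieu M \<Omega> r K. (\<lambda>\<epsilon>. LINT x|lborel. f\<^sub>\<epsilon> \<epsilon> x * \<phi> x) \<in> NC_roumieu M"
  interpret weight_family "roumieu_weight M ` seqs_R"
    by (rule weight_family_roumieu[OF assms(2)])
  show "f = zero_roumieu M \<Omega>"
    unfolding f(2) class_roumieu_def zero_roumieu_def rel_roumieu_def roumieu_eq
    by (rule class_eq_zero_if_weakly_negligible[OF assms(1,3), of _ "roumieu_weight M r"])
      (use f(1) supp weak \<open>r \<in> seqs_R\<close> in \<open>auto simp: roumieu_eq D_roumieu_def\<close>)
qed

end
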